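(* Let $f\in\mathbb{C}[x_1,\ldots,x_n]$ be a nondegenerate homogeneous polynomial of degree $d\ge 3$ with $t$ monomial terms. Computing the center $Z(f)$ takes at most $O(n^3d^3t+n^{d+4})$ arithmetic operations.
   Context: Complexity is counted in arithmetic operations over $\mathbb{C}$, in terms of the number of variables $n$, the degree $d$, and the number $t$ of monomial terms of $f$ (so $t\le\binom{n+d-1}{d}$). A homogeneous polynomial $f\in\mathbb{C}[x_1,\ldots,x_n]$ is nondegenerate if none of its variables can be removed by an invertible linear change of variables. The center of $f$ is $$Z(f)=\{X\in\mathbb{C}^{n\times n}\mid (HX)^T=HX\},$$ where $H=\left(\frac{\partial^2 f}{\partial x_i\partial x_j}\right)_{1\le i,j\le n}$ is the Hessian matrix of $f$ and the equation is an identity of matrices of polynomials, i.e. a system of linear equations over $\mathbb{C}$ in the entries of $X$. Computing the center means solving this linear system: reporting when $\dim Z(f)\neq n$, and otherwise outputting basis matrices $X_1,\ldots,X_n$ of the $\mathbb{C}$-vector space $Z(f)$. *)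

theory Defs
  imports Complex_Main "HOL-Library.Poly_Mapping" "Jordan_Normal_Form.VS_Connect"
begin

section \<open>Polynomials\<close>

text \<open>A polynomial is a finitely supported map from exponent vectors to coefficients, with
  convolution as multiplication; the variables are numbered \<open>0, \<dots>, n - 1\<close>.
  \<open>keys f\<close> is the set of monomials of \<open>f\<close> with nonzero coefficient.\<close>

type_synonym monomial = "nat \<Rightarrow>\<^sub>0 nat"
type_synonym cpoly = "monomial \<Rightarrow>\<^sub>0 complex"

definition const_poly :: "complex \<Rightarrow> cpoly" where
  "const_poly c = Poly_Mapping.single 0 c"

definition var_poly :: "nat \<Rightarrow> cpoly" where
  "var_poly j = Poly_Mapping.single (Poly_Mapping.single j 1) 1"

definition vars :: "cpoly \<Rightarrow> nat set" where
  "vars f = (\<Union>m \<in> Poly_Mapping.keys f. Poly_Mapping.keys m)"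

definition polys_in :: "nat \<Rightarrow> cpoly set" where
  "polys_in n = {f. vars f \<subseteq> {..<n}}"

definition homogeneous :: "nat \<Rightarrow> cpoly \<Rightarrow> bool" where
  "homogeneous d f \<longleftrightarrow> (\<forall>m \<in> Poly_Mapping.keys f.
     (\<Sum>i \<in> Poly_Mapping.keys m. Poly_Mapping.lookup m i) = d)"

text \<open>If \<open>x\<^sub>i\<close> does not occur in \<open>m\<close>, its exponent contributes the factor 0, so the truncated
  subtraction of exponents is harmless.\<close>

definition partial_deriv :: "nat \<Rightarrow> cpoly \<Rightarrow> cpoly" where
  "partial_deriv i f =
     (\<Sum>m \<in> Poly_Mapping.keys f. Poly_Mapping.single (m - Poly_Mapping.single i 1)
                       (of_nat (Poly_Mapping.lookup m i) * Poly_Mapping.lookup f m))"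

text \<open>The polynomial \<open>f(P x)\<close>.\<close>

definition lin_subst :: "nat \<Rightarrow> complex mat \<Rightarrow> cpoly \<Rightarrow> cpoly" where
  "lin_subst n P f =
     (\<Sum>m \<in> Poly_Mapping.keys f. const_poly (Poly_Mapping.lookup f m) *
        (\<Prod>i<n. (\<Sum>j<n. const_poly (P $$ (i, j)) * var_poly j) ^ Poly_Mapping.lookup m i))"

definition nondegenerate :: "nat \<Rightarrow> cpoly \<Rightarrow> bool" where
  "nondegenerate n f \<longleftrightarrow>
     \<not> (\<exists>P \<in> carrier_mat n n. invertible_mat P \<and> (\<exists>i<n. i \<notin> vars (lin_subst n P f)))"

section \<open>The center\<close>

definition hessian :: "nat \<Rightarrow> cpoly \<Rightarrow> cpoly mat" where
  "hessian n f = mat n n (\<lambda>(i, j). partial_deriv i (partial_deriv j f))"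

definition center :: "nat \<Rightarrow> cpoly \<Rightarrow> complex mat set" where
  "center n f = {X \<in> carrier_mat n n.
     transpose_mat (hessian n f * map_mat const_poly X) = hessian n f * map_mat const_poly X}"

definition center_space :: "nat \<Rightarrow> cpoly \<Rightarrow> (complex, complex mat) module" where
  "center_space n f = (module_mat TYPE(complex) n n) \<lparr> carrier := center n f \<rparr>"

lemma map_const_poly_add: "X \<in> carrier_mat n n \<Longrightarrow> Y \<in> carrier_mat n n \<Longrightarrow>
    map_mat const_poly (X + Y) =
      map_mat const_poly X + map_mat const_poly Y"
  by (rule eq_matI) (auto simp: const_poly_def single_add)

lemma map_const_poly_smult: "X \<in> carrier_mat n n \<Longrightarrow>
    map_mat const_poly (a \<cdot>\<^sub>m X) =
      const_poly a \<cdot>\<^sub>m map_mat const_poly X"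
  by (rule eq_matI) (auto simp: const_poly_def mult_single)

lemma hessian_carrier: "hessian n f \<in> carrier_mat n n" by (simp add: hessian_def)

lemma zero_in_center: "0\<^sub>m n n \<in> center n f"
proof -
  have "map_mat const_poly (0\<^sub>m n n) = 0\<^sub>m n n" by (rule eq_matI) (auto simp: const_poly_def)
  then show ?thesis using hessian_carrier[of n f] by (simp add: center_def)
qed

lemma add_in_center: assumes "X \<in> center n f" "Y \<in> center n f" shows "X + Y \<in> center n f"
proof -
  have X: "X \<in> carrier_mat n n" "Y \<in> carrier_mat n n"
    using assms by (auto simp: center_def)
  have "hessian n f * map_mat const_poly (X + Y) =
      hessian n f * map_mat const_poly X + hessian n f * map_mat const_poly Y"
    unfolding map_const_poly_add[OF X]
    using mult_add_distrib_mat[OF hessian_carrier map_carrier_mat[THEN iffD2, OF X(1)] map_carrier_mat[THEN iffD2, OF X(2)]] .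
  then show ?thesis using assms X hessian_carrier[of n f] by (simp add: center_def transpose_add[of _ n n])
qed

lemma smult_in_center: assumes "X \<in> center n f" shows "a \<cdot>\<^sub>m X \<in> center n f"
proof -
  have X: "X \<in> carrier_mat n n" using assms by (auto simp: center_def)
  have e: "hessian n f * map_mat const_poly (a \<cdot>\<^sub>m X) =
      const_poly a \<cdot>\<^sub>m (hessian n f * map_mat const_poly X)"
    unfolding map_const_poly_smult[OF X] using mult_smult_distrib[OF hessian_carrier map_carrier_mat[THEN iffD2, OF X]] .
  have t: "(c \<cdot>\<^sub>m A)\<^sup>T = c \<cdot>\<^sub>m A\<^sup>T" for c and A :: "cpoly mat" by (rule eq_matI) auto
  show ?thesis using assms X by (simp add: center_def e t)
qed

text \<open>By the following, \<open>vectorspace.dim\<close> and \<open>vectorspace.basis\<close> are meaningful for the center.\<close>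

lemma vectorspace_center_space: "vectorspace class_ring (center_space n f)"
proof -
  interpret V: vectorspace "class_ring :: complex ring" "module_mat TYPE(complex) n n" by (rule matrix_vs)
  have "submodule class_ring (center n f) (module_mat TYPE(complex) n n)"
    by (rule submodule.intro)
      (use zero_in_center add_in_center smult_in_center V.module_axioms in \<open>auto simp: module_mat_simps center_def\<close>)
  then have "subspace class_ring (center n f) (module_mat TYPE(complex) n n)"
    using V.vectorspace_axioms by (simp add: subspace_def)
  then show ?thesis unfolding center_space_def by (rule V.subspace_is_vs)
qed

section \<open>Programs with arithmetic over the complex numbers\<close>

text \<open>The model is a while language over two kinds of arrays, indexed by natural numbers: arrays of
  natural numbers (for control, indices and exponents) and arrays of complex numbers. A scalar is
  the entry at index 0. Programs are finite syntactic objects, so a single one has to serve all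
  inputs. Complex numbers enter only as input coefficients, as the constants 0 and 1, or as results
  of arithmetic operations; in particular there is no cast from natural numbers.\<close>

type_synonym name = string

record store =
  nats :: "name \<Rightarrow> nat \<Rightarrow> nat"
  nums :: "name \<Rightarrow> nat \<Rightarrow> complex"

datatype nexp =
    NConst nat
  | NElem name nexp
  | NAdd nexp nexp
  | NSub nexp nexp
  | NMul nexp nexp
  | NDiv nexp nexp
  | NMod nexp nexp

fun nval :: "nexp \<Rightarrow> store \<Rightarrow> nat" where
  "nval (NConst c) s = c"
| "nval (NElem a e) s = nats s a (nval e s)"
| "nval (NAdd e e') s = nval e s + nval e' s"
| "nval (NSub e e') s = nval e s - nval e' s"
| "nval (NMul e e') s = nval e s * nval e' s"
| "nval (NDiv e e') s = nval e s div nval e' s"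
| "nval (NMod e e') s = nval e s mod nval e' s"

datatype bexp =
    BEq nexp nexp
  | BLess nexp nexp
  | BNot bexp
  | BAnd bexp bexp

fun bval :: "bexp \<Rightarrow> store \<Rightarrow> bool" where
  "bval (BEq e e') s \<longleftrightarrow> nval e s = nval e' s"
| "bval (BLess e e') s \<longleftrightarrow> nval e s < nval e' s"
| "bval (BNot b) s \<longleftrightarrow> \<not> bval b s"
| "bval (BAnd b b') s \<longleftrightarrow> bval b s \<and> bval b' s"

datatype arith_op = Add | Sub | Mul | Div

fun arith :: "arith_op \<Rightarrow> complex \<Rightarrow> complex \<Rightarrow> complex" where
  "arith Add x y = x + y"
| "arith Sub x y = x - y"
| "arith Mul x y = x * y"
| "arith Div x y = x / y"

text \<open>A complex cell: array name and index expression.\<close>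

type_synonym cell = "name \<times> nexp"

definition get :: "cell \<Rightarrow> store \<Rightarrow> complex" where
  "get r s = nums s (fst r) (nval (snd r) s)"

definition put :: "cell \<Rightarrow> complex \<Rightarrow> store \<Rightarrow> store" where
  "put r z s = s \<lparr> nums := (nums s)(fst r := (nums s (fst r))(nval (snd r) s := z)) \<rparr>"

definition put_nat :: "name \<Rightarrow> nexp \<Rightarrow> nexp \<Rightarrow> store \<Rightarrow> store" where
  "put_nat a i e s = s \<lparr> nats := (nats s)(a := (nats s a)(nval i s := nval e s)) \<rparr>"

datatype com =
    Skip
  | AssignNat name nexp nexp
  | SetZero cell
  | SetOne cell
  | Copy cell cell
  | Arith arith_op cell cell cell
  | Seq com com
  | IfNat bexp com com
  | IfZero cell com com
  | While bexp com

text \<open>\<open>exec c s k s'\<close>: from store \<open>s\<close>, the program \<open>c\<close> terminates in \<open>s'\<close> after \<open>k\<close> arithmetic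
  operations over the complex numbers. Tests of a complex number for zero are counted too; data
  movement and the handling of natural numbers are not. A division by zero has no successor.\<close>

inductive exec :: "com \<Rightarrow> store \<Rightarrow> nat \<Rightarrow> store \<Rightarrow> bool" where
  Skip: "exec Skip s 0 s"
| AssignNat: "exec (AssignNat a i e) s 0 (put_nat a i e s)"
| SetZero: "exec (SetZero r) s 0 (put r 0 s)"
| SetOne: "exec (SetOne r) s 0 (put r 1 s)"
| Copy: "exec (Copy r q) s 0 (put r (get q s) s)"
| Arith: "(bop = Div \<Longrightarrow> get q' s \<noteq> 0) \<Longrightarrow>
    exec (Arith bop r q q') s 1 (put r (arith bop (get q s) (get q' s)) s)"
| Seq: "exec c s k s' \<Longrightarrow> exec c' s' k' s'' \<Longrightarrow> exec (Seq c c') s (k + k') s''"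
| IfTrue: "bval b s \<Longrightarrow> exec c s k s' \<Longrightarrow> exec (IfNat b c c') s k s'"
| IfFalse: "\<not> bval b s \<Longrightarrow> exec c' s k s' \<Longrightarrow> exec (IfNat b c c') s k s'"
| IfZeroTrue: "get r s = 0 \<Longrightarrow> exec c s k s' \<Longrightarrow> exec (IfZero r c c') s (Suc k) s'"
| IfZeroFalse: "get r s \<noteq> 0 \<Longrightarrow> exec c' s k s' \<Longrightarrow> exec (IfZero r c c') s (Suc k) s'"
| WhileFalse: "\<not> bval b s \<Longrightarrow> exec (While b c) s 0 s"
| WhileTrue: "bval b s \<Longrightarrow> exec c s k s' \<Longrightarrow> exec (While b c) s' k' s'' \<Longrightarrow>
    exec (While b c) s (k + k') s''"

section \<open>Computing the center\<close>

text \<open>Input is the sparse representation of \<open>f\<close>, where \<open>ms\<close> lists its monomials in some order: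
  \<open>E[k * n + i]\<close> is the exponent of \<open>x\<^sub>i\<close> in the \<open>k\<close>-th term and \<open>C[k]\<close> the coefficient of that
  term. All other cells are zero.\<close>

definition input_store :: "nat \<Rightarrow> nat \<Rightarrow> monomial list \<Rightarrow> cpoly \<Rightarrow> store" where
  "input_store n d ms f =
     \<lparr> nats = (\<lambda>_ _. 0)
        (''n'' := (\<lambda>_. 0)(0 := n),
         ''d'' := (\<lambda>_. 0)(0 := d),
         ''t'' := (\<lambda>_. 0)(0 := length ms),
         ''E'' := (\<lambda>p. if p < length ms * n
                       then Poly_Mapping.lookup (ms ! (p div n)) (p mod n) else 0)),
       nums = (\<lambda>_ _. 0)
        (''C'' := (\<lambda>k. if k < length ms then Poly_Mapping.lookup f (ms ! k) else 0)) \<rparr>"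

text \<open>On output the flag \<open>ok\<close> is 0 to report \<open>dim Z(f) \<noteq> n\<close>; otherwise it is 1, and the array
  \<open>X\<close> holds the basis matrices one after the other in row-major order.\<close>

definition output_mats :: "nat \<Rightarrow> store \<Rightarrow> complex mat list" where
  "output_mats n s = map (\<lambda>k. mat n n (\<lambda>(i, j). nums s ''X'' (k * n * n + i * n + j))) [0..<n]"

definition outputs_center :: "nat \<Rightarrow> cpoly \<Rightarrow> store \<Rightarrow> bool" where
  "outputs_center n f s \<longleftrightarrow>
     (if vectorspace.dim class_ring (center_space n f) = n
      then nats s ''ok'' 0 = 1 \<and> distinct (output_mats n s) \<and>
           vectorspace.basis class_ring (center_space n f) (set (output_mats n s))
      else nats s ''ok'' 0 = 0)"

end

theory Submission
  imports Defs
begin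

text \<open>The center is the solution space of linear equations in the \<open>n\<^sup>2\<close> entries of \<open>X\<close>: for all \<open>i\<close>,
  \<open>j\<close> and all monomials \<open>m\<close>, the coefficients of \<open>m\<close> in the entries \<open>(i, j)\<close> and \<open>(j, i)\<close> of \<open>H X\<close>
  agree. As \<open>f\<close> is homogeneous, only monomials \<open>m\<close> of degree \<open>d - 2\<close> matter, and each is a product of
  \<open>d - 2\<close> variables; so \<open>n\<^sup>2 n ^ (d - 2) = n ^ d\<close> equations suffice
  (\<open>mat_of_in_center_iff\<close>), numbered by \<open>y < n ^ d\<close> through their digits in base \<open>n\<close>.

  The coefficients of the equations are coefficients of second derivatives of \<open>f\<close>, that is, coefficients
  of \<open>f\<close> times natural numbers up to \<open>d\<^sup>2\<close>. They are tabulated once, by repeated addition, with at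
  most \<open>n\<^sup>2 d\<^sup>2 t\<close> additions (\<open>runs_tabulate_derivatives\<close>). Since operations on natural numbers are
  not counted, finding the table entries that belong to an equation is free, and writing the equation
  down takes \<open>2 n\<close> operations (\<open>runs_write_equation\<close>).

  The equations are inserted one after the other into a system in echelon form, which never has more
  than \<open>n\<^sup>2\<close> rows of length \<open>n\<^sup>2\<close>. Hence one insertion takes at most \<open>n\<^sup>2 + 2 n\<^sup>4\<close> operations
  (\<open>runs_insert_row\<close>), and the elimination takes \<open>O(n ^ (d + 4))\<close> operations in total. Inserting
  row by row is essential for this bound: it keeps the length and the number of the stored rows
  independent of the number of equations.

  The dimension of the center is the number of columns without pivot (\<open>fundamental_basis\<close>). If it is \<open>n\<close>,
  then \<open>n\<close> back substitutions, of at most \<open>2 n\<^sup>4\<close> operations each, give the fundamental solutions, which form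
  a basis.\<close>

section \<open>Bounded executions\<close>

text \<open>Total correctness together with a bound on the cost; the correctness statements about
  program fragments all have this form.\<close>

definition runs :: "com \<Rightarrow> store \<Rightarrow> nat \<Rightarrow> (store \<Rightarrow> bool) \<Rightarrow> bool" where
  "runs c s b Q \<longleftrightarrow> (\<exists>k s'. exec c s k s' \<and> k \<le> b \<and> Q s')"

lemma runs_conseq:
  "runs c s b Q \<Longrightarrow> (\<And>s'. Q s' \<Longrightarrow> Q' s') \<Longrightarrow> b \<le> b' \<Longrightarrow> runs c s b' Q'"
  unfolding runs_def by (meson le_trans)

lemma runs_Skip: "Q s \<Longrightarrow> runs Skip s b Q"
  unfolding runs_def by (blast intro: exec.Skip)

lemma runs_AssignNat: "Q (put_nat a i e s) \<Longrightarrow> runs (AssignNat a i e) s b Q"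
  unfolding runs_def by (blast intro: exec.AssignNat)

lemma runs_SetZero: "Q (put r 0 s) \<Longrightarrow> runs (SetZero r) s b Q"
  unfolding runs_def by (blast intro: exec.SetZero)

lemma runs_SetOne: "Q (put r 1 s) \<Longrightarrow> runs (SetOne r) s b Q"
  unfolding runs_def by (blast intro: exec.SetOne)

lemma runs_Copy: "Q (put r (get q s) s) \<Longrightarrow> runs (Copy r q) s b Q"
  unfolding runs_def by (blast intro: exec.Copy)

lemma runs_Arith:
  "Q (put r (arith bop (get q s) (get q' s)) s) \<Longrightarrow> 1 \<le> b \<Longrightarrow> (bop = Div \<Longrightarrow> get q' s \<noteq> 0)
    \<Longrightarrow> runs (Arith bop r q q') s b Q"
  unfolding runs_def by (blast intro: exec.Arith)

lemma runs_Seq: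
  "runs c s b (\<lambda>s'. runs c' s' b' Q) \<Longrightarrow> runs (Seq c c') s (b + b') Q"
  unfolding runs_def by (meson exec.Seq add_mono)

text \<open>Variants for components without cost, which leave the bound untouched.\<close>

lemma runs_Seq_free: "runs c s 0 (\<lambda>s'. runs c' s' b Q) \<Longrightarrow> runs (Seq c c') s b Q"
  using runs_Seq[of c s 0 c' b Q] by simp

lemma runs_Seq_free_last: "runs c s b (\<lambda>s'. runs c' s' 0 Q) \<Longrightarrow> runs (Seq c c') s b Q"
  using runs_Seq[of c s b c' 0 Q] by simp

lemma runs_IfNat:
  "(bval b s \<Longrightarrow> runs c s k Q) \<Longrightarrow> (\<not> bval b s \<Longrightarrow> runs c' s k Q) \<Longrightarrow> runs (IfNat b c c') s k Q"
  unfolding runs_def by (meson exec.IfTrue exec.IfFalse)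

lemma runs_IfZero:
  assumes "get r s = 0 \<Longrightarrow> runs c s k Q" "get r s \<noteq> 0 \<Longrightarrow> runs c' s k Q"
  shows "runs (IfZero r c c') s (Suc k) Q"
  using assms unfolding runs_def by (meson exec.IfZeroTrue exec.IfZeroFalse Suc_le_mono)

text \<open>The frame property: a program changes only the arrays that it assigns to, which can be read
  off its syntax. This lets specifications of fragments mention only what they compute.\<close>

fun nat_writes :: "com \<Rightarrow> name set" where
  "nat_writes (AssignNat a i e) = {a}"
| "nat_writes (Seq c c') = nat_writes c \<union> nat_writes c'"
| "nat_writes (IfNat b c c') = nat_writes c \<union> nat_writes c'"
| "nat_writes (IfZero r c c') = nat_writes c \<union> nat_writes c'"
| "nat_writes (While b c) = nat_writes c"
| "nat_writes _ = {}"

fun num_writes :: "com \<Rightarrow> name set" where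
  "num_writes (SetZero r) = {fst r}"
| "num_writes (SetOne r) = {fst r}"
| "num_writes (Copy r q) = {fst r}"
| "num_writes (Arith bop r q q') = {fst r}"
| "num_writes (Seq c c') = num_writes c \<union> num_writes c'"
| "num_writes (IfNat b c c') = num_writes c \<union> num_writes c'"
| "num_writes (IfZero r c c') = num_writes c \<union> num_writes c'"
| "num_writes (While b c) = num_writes c"
| "num_writes _ = {}"

definition same_outside :: "name set \<Rightarrow> name set \<Rightarrow> store \<Rightarrow> store \<Rightarrow> bool" where
  "same_outside A B s s' \<longleftrightarrow>
     (\<forall>a. a \<notin> A \<longrightarrow> nats s' a = nats s a) \<and> (\<forall>a. a \<notin> B \<longrightarrow> nums s' a = nums s a)"

lemma same_outside_nats: "same_outside A B s s' \<Longrightarrow> a \<notin> A \<Longrightarrow> nats s' a = nats s a"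
  and same_outside_nums: "same_outside A B s s' \<Longrightarrow> a \<notin> B \<Longrightarrow> nums s' a = nums s a"
  by (auto simp: same_outside_def)

lemma exec_same_outside: "exec c s k s' \<Longrightarrow> same_outside (nat_writes c) (num_writes c) s s'"
  by (induction rule: exec.induct) (auto simp: same_outside_def put_def put_nat_def)

lemma runs_frame:
  "runs c s b Q \<Longrightarrow> runs c s b (\<lambda>s'. Q s' \<and> same_outside (nat_writes c) (num_writes c) s s')"
  unfolding runs_def using exec_same_outside by blast

text \<open>The form in which the specification of a fragment is applied at one of its calls.\<close>

lemma runs_call:
  assumes "runs c s b Q"
    and "\<And>s'. Q s' \<Longrightarrow> same_outside (nat_writes c) (num_writes c) s s' \<Longrightarrow> Q' s'"
  shows "runs c s b Q'"
  using runs_frame[OF assms(1)] assms(2) by (rule runs_conseq) auto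

section \<open>Counting loops\<close>

abbreviation scalar :: "name \<Rightarrow> nexp" where
  "scalar a \<equiv> NElem a (NConst 0)"

definition for_loop :: "name \<Rightarrow> nexp \<Rightarrow> com \<Rightarrow> com" where
  "for_loop v e c =
     Seq (AssignNat v (NConst 0) (NConst 0))
       (While (BLess (scalar v) e)
         (Seq c (AssignNat v (NConst 0) (NAdd (scalar v) (NConst 1)))))"

lemma writes_for_loop [simp]:
  "nat_writes (for_loop v e c) = insert v (nat_writes c)"
  "num_writes (for_loop v e c) = num_writes c"
  by (auto simp: for_loop_def)

fun nat_reads :: "nexp \<Rightarrow> name set" where
  "nat_reads (NConst c) = {}"
| "nat_reads (NElem a e) = insert a (nat_reads e)"
| "nat_reads (NAdd e e') = nat_reads e \<union> nat_reads e'"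
| "nat_reads (NSub e e') = nat_reads e \<union> nat_reads e'"
| "nat_reads (NMul e e') = nat_reads e \<union> nat_reads e'"
| "nat_reads (NDiv e e') = nat_reads e \<union> nat_reads e'"
| "nat_reads (NMod e e') = nat_reads e \<union> nat_reads e'"

lemma nval_same_outside:
  "same_outside A B s s' \<Longrightarrow> nat_reads e \<inter> A = {} \<Longrightarrow> nval e s' = nval e s"
  by (induction e) (auto simp: same_outside_def Int_Un_distrib2)

definition set_scalar :: "name \<Rightarrow> nat \<Rightarrow> store \<Rightarrow> store" where
  "set_scalar v i s = s \<lparr> nats := (nats s)(v := (nats s v)(0 := i)) \<rparr>"

lemma put_nat_scalar: "put_nat v (NConst 0) e s = set_scalar v (nval e s) s"
  by (simp add: put_nat_def set_scalar_def)

lemma set_scalar_sel [simp]: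
  "nums (set_scalar v i s) = nums s"
  "nats (set_scalar v i s) v 0 = i"
  "a \<noteq> v \<Longrightarrow> nats (set_scalar v i s) a = nats s a"
  by (simp_all add: set_scalar_def)

lemma same_outside_set_scalar: "v \<in> A \<Longrightarrow> same_outside A B s (set_scalar v i s)"
  by (auto simp: same_outside_def set_scalar_def)

text \<open>The invariant \<open>I\<close> need not speak of the counter \<open>v\<close>: its value is supplied as the argument
  of \<open>I\<close>, and \<open>I\<close> has to be insensitive to assignments to \<open>v\<close>. The frame facts relate every
  iteration to the store \<open>s\<close> before the loop.\<close>

lemma runs_for_loop:
  fixes I :: "nat \<Rightarrow> store \<Rightarrow> bool"
  assumes N: "nval e s = N"
    and reads: "nat_reads e \<inter> insert v (nat_writes c) = {}" and v: "v \<notin> nat_writes c"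
    and counter: "\<And>i x s'. I i (set_scalar v x s') = I i s'"
    and init: "I 0 s"
    and step: "\<And>i s'. i < N \<Longrightarrow> I i s' \<Longrightarrow> nats s' v 0 = i \<Longrightarrow>
      same_outside (insert v (nat_writes c)) (num_writes c) s s' \<Longrightarrow> runs c s' b (I (Suc i))"
    and post: "\<And>s'. I N s' \<Longrightarrow> 
      same_outside (insert v (nat_writes c)) (num_writes c) s s' \<Longrightarrow> Q s'"
    and b: "N * b \<le> b'"
  shows "runs (for_loop v e c) s b' Q"
proof -
  let ?same = "same_outside (insert v (nat_writes c)) (num_writes c)"
  let ?w = "While (BLess (scalar v) e)
    (Seq c (AssignNat v (NConst 0) (NAdd (scalar v) (NConst 1))))"
  have loop: "i \<le> N \<Longrightarrow> I i s' \<Longrightarrow> nats s' v 0 = i \<Longrightarrow> ?same s s' \<Longrightarrow>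
    \<exists>k s''. exec ?w s' k s'' \<and> k \<le> (N - i) * b \<and> I N s'' \<and> ?same s s''" for i s'
  proof (induction "N - i" arbitrary: i s')
    case 0
    then have "nval e s' = i" "i = N" using nval_same_outside[OF 0(5) reads] N by auto
    then have "\<not> bval (BLess (scalar v) e) s'" using 0 by simp
    then have "exec ?w s' 0 s'" by (rule exec.WhileFalse)
    then show ?case using 0 \<open>i = N\<close> by blast
  next
    case (Suc m)
    have lt: "i < N" using Suc(2) by simp
    have "nval e s' = N" using nval_same_outside[OF Suc(6) reads] N by auto
    then have bv: "bval (BLess (scalar v) e) s'" using Suc lt by simp
    obtain k s1 where s1: "exec c s' k s1" "k \<le> b" "I (Suc i) s1"
      using step[OF lt Suc(4-6)] unfolding runs_def by blast
    have same1: "same_outside (nat_writes c) (num_writes c) s' s1"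
      by (rule exec_same_outside[OF s1(1)])
    have v1: "nats s1 v 0 = i" using same_outside_nats[OF same1 v] Suc(5) by simp
    let ?s2 = "set_scalar v (Suc i) s1"
    have e2: "exec (Seq c (AssignNat v (NConst 0) (NAdd (scalar v) (NConst 1)))) s' (k + 0) ?s2"
      using exec.Seq[OF s1(1) exec.AssignNat[of v "NConst 0" "NAdd (scalar v) (NConst 1)"]] v1
      by (simp add: put_nat_scalar)
    have same2: "?same s ?s2"
      using Suc(6) same1 by (auto simp: same_outside_def)
    have "I (Suc i) ?s2" using s1(3) counter by simp
    then obtain k' s'' where s'': "exec ?w ?s2 k' s''" "k' \<le> (N - Suc i) * b" "I N s''" "?same s s''"
      using Suc(1)[of "Suc i" ?s2, OF _ _ _ _ same2] Suc(2) lt by fastforce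
    have "exec ?w s' (k + 0 + k') s''" by (rule exec.WhileTrue[OF bv e2 s''(1)])
    moreover have "k + 0 + k' \<le> (N - i) * b"
    proof -
      have "N - i = Suc (N - Suc i)" using lt by simp
      then show ?thesis using s''(2) s1(2) by simp
    qed
    ultimately show ?case using s'' by blast
  qed
  let ?s0 = "set_scalar v 0 s"
  obtain k s' where s': "exec ?w ?s0 k s'" "k \<le> N * b" "I N s'" "?same s s'"
    using loop[of 0 ?s0] init counter same_outside_set_scalar[of v "insert v (nat_writes c)"]
    by auto
  have "exec (for_loop v e c) s (0 + k) s'"
    unfolding for_loop_def
    using exec.Seq[OF exec.AssignNat[of v "NConst 0" "NConst 0" s]] s'(1)
    by (simp add: put_nat_scalar)
  then show ?thesis unfolding runs_def using s' post b by fastforce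
qed

section \<open>The linear system of the center\<close>

abbreviation "lookup \<equiv> Poly_Mapping.lookup"
abbreviation "single \<equiv> Poly_Mapping.single"
abbreviation "keys \<equiv> Poly_Mapping.keys"

lemma lookup_partial_deriv:
  "lookup (partial_deriv i f) m = of_nat (Suc (lookup m i)) * lookup f (m + single i 1)"
proof -
  have eq: "lookup (single (m' - single i 1) (of_nat (lookup m' i) * lookup f m')) m =
      (if m' = m + single i 1 then of_nat (Suc (lookup m i)) * lookup f (m + single i 1) else 0)"
    for m'
  proof (cases "lookup m' i = 0")
    case True
    then have "m' \<noteq> m + single i 1" by (auto simp: lookup_add lookup_single)
    with True show ?thesis by (simp add: lookup_single)
  next
    case False
    have "m' - single i 1 = m \<longleftrightarrow> m' = m + single i 1"
    proof
      assume "m' - single i 1 = m"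
      then have "lookup m k = lookup m' k - lookup (single i 1) k" for k
        by (metis lookup_minus)
      then have "lookup m' k = lookup m k + lookup (single i 1) k" for k
        using False by (cases "k = i") (simp_all add: lookup_single)
      then show "m' = m + single i 1"
        by (intro poly_mapping_eqI) (simp add: lookup_add)
    qed simp
    then show ?thesis by (auto simp: lookup_single lookup_add when_def)
  qed
  show ?thesis
    unfolding partial_deriv_def lookup_sum eq
    by (simp add: sum.delta[OF finite_keys] in_keys_iff)
qed

lemma lookup_times_const_poly: "lookup (p * const_poly c) m = lookup p m * c"
proof -
  have "(lookup (single 0 c) q when k = l + q) = ((c when k = l) when q = 0)" for k l q :: monomial
    by (auto simp: lookup_single when_def)
  then show ?thesis unfolding const_poly_def
    by (simp add: lookup_mult mult_when)
qed

definition hess_coeff :: "cpoly \<Rightarrow> nat \<Rightarrow> nat \<Rightarrow> monomial \<Rightarrow> complex" where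
  "hess_coeff f i l m = lookup (partial_deriv i (partial_deriv l f)) m"

text \<open>The natural factor is a function of the monomial of \<open>f\<close> alone, so the coefficients of all
  second derivatives can be tabulated term by term.\<close>

lemma hess_coeff_eq:
  assumes "m' = m + single i 1 + single l 1"
  shows "hess_coeff f i l m =
    of_nat (lookup m' l * (lookup m' i - (if i = l then 1 else 0))) * lookup f m'"
  using assms
  by (auto simp: hess_coeff_def lookup_partial_deriv lookup_add lookup_single algebra_simps)

lemma center_iff:
  assumes X: "X \<in> carrier_mat n n"
  shows "X \<in> center n f \<longleftrightarrow> (\<forall>i<n. \<forall>j<n. \<forall>m.
    (\<Sum>l<n. hess_coeff f i l m * X $$ (l, j)) = (\<Sum>l<n. hess_coeff f j l m * X $$ (l, i)))"
proof -
  let ?P = "hessian n f * map_mat const_poly X"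
  have entry: "?P $$ (i, j) =
      (\<Sum>l<n. partial_deriv i (partial_deriv l f) * const_poly (X $$ (l, j)))"
    if "i < n" "j < n" for i j
    using that X by (simp add: hessian_def scalar_prod_def lessThan_atLeast0)
  have P: "?P \<in> carrier_mat n n" using X hessian_carrier[of n f] by simp
  have symmetric: "Q\<^sup>T = Q \<longleftrightarrow> (\<forall>i<n. \<forall>j<n. Q $$ (i, j) = Q $$ (j, i))"
    if "Q \<in> carrier_mat n n" for Q :: "cpoly mat"
  proof
    assume "Q\<^sup>T = Q"
    then show "\<forall>i<n. \<forall>j<n. Q $$ (i, j) = Q $$ (j, i)"
      using that by (metis carrier_matD index_transpose_mat(1))
  next
    assume "\<forall>i<n. \<forall>j<n. Q $$ (i, j) = Q $$ (j, i)"
    then show "Q\<^sup>T = Q" using that by (intro eq_matI) auto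
  qed
  have "X \<in> center n f \<longleftrightarrow> ?P\<^sup>T = ?P" using X by (simp add: center_def)
  also have "\<dots> \<longleftrightarrow> (\<forall>i<n. \<forall>j<n. ?P $$ (i, j) = ?P $$ (j, i))" by (rule symmetric[OF P])
  also have "\<dots> \<longleftrightarrow> (\<forall>i<n. \<forall>j<n. \<forall>m. lookup (?P $$ (i, j)) m = lookup (?P $$ (j, i)) m)"
    by (metis poly_mapping_eqI)
  finally show ?thesis
    by (simp add: entry lookup_sum lookup_times_const_poly hess_coeff_def)
qed

text \<open>The monomials of degree \<open>w\<close> in \<open>n\<close> variables are the products of \<open>w\<close> variables, so they can be
  enumerated, with repetitions, by the \<open>n ^ w\<close> numbers with \<open>w\<close> digits in base \<open>n\<close>. The repetitions
  are harmless: the cost bound for the center allows for \<open>n ^ w\<close> monomials.\<close>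

fun digit_mono :: "nat \<Rightarrow> nat \<Rightarrow> nat \<Rightarrow> monomial" where
  "digit_mono n 0 q = 0"
| "digit_mono n (Suc w) q = single (q mod n) 1 + digit_mono n w (q div n)"

lemma keys_digit_mono: "n > 0 \<Longrightarrow> keys (digit_mono n w q) \<subseteq> {..<n}"
proof (induction w arbitrary: q)
  case (Suc w)
  have "keys (digit_mono n (Suc w) q) \<subseteq>
      keys (single (q mod n) (1::nat)) \<union> keys (digit_mono n w (q div n))"
    unfolding digit_mono.simps by (rule Poly_Mapping.keys_add)
  also have "\<dots> \<subseteq> {..<n}" using Suc by auto
  finally show ?case .
qed simp

lemma digit_mono_surj:
  assumes "keys m \<subseteq> {..<n}" "(\<Sum>i<n. lookup m i) = w"
  shows "\<exists>q<n ^ w. digit_mono n w q = m"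
  using assms
proof (induction w arbitrary: m)
  case 0
  then have "lookup m i = 0" for i
    by (cases "i < n") (auto simp: in_keys_iff)
  then show ?case by (auto intro: poly_mapping_eqI)
next
  case (Suc w)
  obtain v where v: "v < n" "lookup m v > 0"
    using Suc.prems(2) by (metis lessThan_iff neq0_conv nat.distinct(1) sum.neutral)
  let ?m = "m - single v 1"
  have m: "m = single v 1 + ?m"
    using v by (intro poly_mapping_eqI) (auto simp: lookup_add lookup_minus lookup_single when_def)
  have "keys ?m \<subseteq> keys m" by (auto simp: in_keys_iff lookup_minus)
  moreover have "(\<Sum>i<n. lookup m i) = (\<Sum>i<n. lookup (single v 1) i) + (\<Sum>i<n. lookup ?m i)"
    unfolding sum.distrib[symmetric] by (intro sum.cong refl) (metis m lookup_add)
  then have "(\<Sum>i<n. lookup ?m i) = w"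
    using v Suc.prems(2) by (simp add: lookup_single when_def)
  ultimately obtain q where q: "q < n ^ w" "digit_mono n w q = ?m" using Suc by blast
  have "v + n * q < n * Suc q" using v by simp
  also have "\<dots> \<le> n * n ^ w" using q by (intro mult_le_mono2) simp
  finally have "v + n * q < n ^ Suc w" by simp
  moreover have "digit_mono n (Suc w) (v + n * q) = m" using v q m by simp
  ultimately show ?case by blast
qed

definition dot :: "nat \<Rightarrow> (nat \<Rightarrow> complex) \<Rightarrow> (nat \<Rightarrow> complex) \<Rightarrow> complex" where
  "dot N r x = (\<Sum>c<N. r c * x c)"

definition mat_of :: "nat \<Rightarrow> (nat \<Rightarrow> complex) \<Rightarrow> complex mat" where
  "mat_of n x = mat n n (\<lambda>(i, j). x (i * n + j))"

lemma mat_of_carrier [simp]: "mat_of n x \<in> carrier_mat n n"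
  by (simp add: mat_of_def)

lemma pair_index_less: "i < n \<Longrightarrow> j < n \<Longrightarrow> i * n + j < n * (n::nat)"
proof -
  assume "i < n" "j < n"
  then have "i * n + j < Suc i * n" by simp
  also have "\<dots> \<le> n * n" using \<open>i < n\<close> by (intro mult_le_mono1) simp
  finally show ?thesis .
qed

lemma mat_of_index: "p < n * n \<Longrightarrow> mat_of n x $$ (p div n, p mod n) = x p"
  by (cases "n = 0") (auto simp: mat_of_def less_mult_imp_div_less)

lemma mat_of_eq_iff: "mat_of n x = mat_of n y \<longleftrightarrow> (\<forall>p<n * n. x p = y p)"
proof
  show "mat_of n x = mat_of n y \<Longrightarrow> \<forall>p<n * n. x p = y p" by (metis mat_of_index)
  show "\<forall>p<n * n. x p = y p \<Longrightarrow> mat_of n x = mat_of n y"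
    by (rule eq_matI) (auto simp: mat_of_def pair_index_less)
qed

lemma mat_of_cover: "X \<in> carrier_mat n n \<Longrightarrow> X = mat_of n (\<lambda>p. X $$ (p div n, p mod n))"
  by (rule eq_matI) (auto simp: mat_of_def)

text \<open>The coefficient vector of the equation that compares the coefficients of \<open>m\<close> in the entries
  \<open>(i, j)\<close> and \<open>(j, i)\<close> of \<open>H X\<close>. The unknown \<open>X\<^sub>l\<^sub>c\<close> has number \<open>l * n + c\<close>.\<close>

definition equation :: "nat \<Rightarrow> cpoly \<Rightarrow> monomial \<Rightarrow> nat \<Rightarrow> nat \<Rightarrow> nat \<Rightarrow> complex" where
  "equation n f m i j p =
     (if p mod n = j then hess_coeff f i (p div n) m else 0) -
     (if p mod n = i then hess_coeff f j (p div n) m else 0)"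

lemma sum_square_index: "(\<Sum>p<n * n. g p) = (\<Sum>l<n. \<Sum>c<n. g (l * n + c))"
  for g :: "nat \<Rightarrow> 'a::comm_monoid_add"
proof -
  have "sum g {l * n..<l * n + n} = (\<Sum>c<n. g (l * n + c))" for l
    using sum.shift_bounds_nat_ivl[of g 0 "l * n" n]
    by (simp add: lessThan_atLeast0 add.commute)
  then show ?thesis using sum.nat_group[of g n n] by simp
qed

lemma dot_equation:
  assumes "i < n" "j < n"
  shows "dot (n * n) (equation n f m i j) x =
    (\<Sum>l<n. hess_coeff f i l m * mat_of n x $$ (l, j)) -
    (\<Sum>l<n. hess_coeff f j l m * mat_of n x $$ (l, i))"
proof -
  have "dot (n * n) (equation n f m i j) x =
      (\<Sum>l<n. \<Sum>c<n. equation n f m i j (l * n + c) * x (l * n + c))"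
    unfolding dot_def by (rule sum_square_index)
  also have "\<dots> = (\<Sum>l<n. \<Sum>c<n. (if c = j then hess_coeff f i l m * x (l * n + j) else 0) -
      (if c = i then hess_coeff f j l m * x (l * n + i) else 0))"
    by (intro sum.cong refl) (auto simp: equation_def algebra_simps)
  also have "\<dots> = (\<Sum>l<n. hess_coeff f i l m * x (l * n + j) - hess_coeff f j l m * x (l * n + i))"
    using assms by (simp add: sum_subtractf)
  finally show ?thesis using assms by (simp add: sum_subtractf mat_of_def)
qed

text \<open>The number \<open>y = (q * n + i) * n + j\<close> encodes the monomial \<open>digit_mono n (d - 2) q\<close> and the
  position \<open>(i, j)\<close>. For \<open>i = j\<close> the equation is trivial.\<close>

definition numbered_equation :: "nat \<Rightarrow> nat \<Rightarrow> cpoly \<Rightarrow> nat \<Rightarrow> nat \<Rightarrow> complex" where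
  "numbered_equation n d f y =
     equation n f (digit_mono n (d - 2) (y div (n * n))) (y div n mod n) (y mod n)"

text \<open>Since \<open>f\<close> is homogeneous, only monomials of degree \<open>d - 2\<close> occur in the Hessian. Hence
  \<open>n ^ (d - 2)\<close> monomials and \<open>n\<^sup>2\<close> positions give all conditions on the center.\<close>

lemma mat_of_in_center_iff:
  assumes n: "n > 0" and d: "d \<ge> 2" and f: "f \<in> polys_in n" "homogeneous d f"
  shows "mat_of n x \<in> center n f \<longleftrightarrow>
    (\<forall>y<n ^ d. dot (n * n) (numbered_equation n d f y) x = 0)"
proof -
  have "mat_of n x \<in> center n f \<longleftrightarrow>
      (\<forall>i<n. \<forall>j<n. \<forall>m. dot (n * n) (equation n f m i j) x = 0)"
    by (subst center_iff) (simp_all add: dot_equation)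
  also have "\<dots> \<longleftrightarrow> (\<forall>y<n ^ d. dot (n * n) (numbered_equation n d f y) x = 0)"
  proof (intro iffI allI impI)
    fix y assume "\<forall>i<n. \<forall>j<n. \<forall>m. dot (n * n) (equation n f m i j) x = 0"
    then show "dot (n * n) (numbered_equation n d f y) x = 0"
      using n by (simp add: numbered_equation_def)
  next
    fix i j m
    assume eqs: "\<forall>y<n ^ d. dot (n * n) (numbered_equation n d f y) x = 0" and ij: "i < n" "j < n"
    show "dot (n * n) (equation n f m i j) x = 0"
    proof (cases "keys m \<subseteq> {..<n} \<and> (\<Sum>v<n. lookup m v) = d - 2")
      case True
      then obtain q where q: "q < n ^ (d - 2)" "digit_mono n (d - 2) q = m"
        using digit_mono_surj by blast
      define y where "y = (q * n + i) * n + j"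
      have y: "y mod n = j" "y div n = q * n + i" "y div (n * n) = q"
        using ij by (auto simp: y_def div_mult2_eq)
      have "y < Suc q * (n * n)"
        using pair_index_less[OF ij] by (simp add: y_def algebra_simps)
      also have "\<dots> \<le> n ^ (d - 2) * (n * n)" using q by (intro mult_le_mono1) simp
      also have "\<dots> = n ^ d" using d
        by (metis le_add_diff_inverse2 power2_eq_square power_add)
      finally have "y < n ^ d" .
      moreover have "numbered_equation n d f y = equation n f m i j"
        using ij q y by (simp add: numbered_equation_def)
      ultimately show ?thesis using eqs by metis
    next
      case False
      \<comment> \<open>A nonzero coefficient would come from the monomial \<open>m x\<^sub>a x\<^sub>l\<close> of \<open>f\<close>, which forces \<open>m\<close> to
        have degree \<open>d - 2\<close> and to involve only the first \<open>n\<close> variables.\<close>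
      have zero: "hess_coeff f a l m = 0" if "a < n" "l < n" for a l
      proof (rule ccontr)
        let ?m = "m + single a 1 + single l 1"
        assume "hess_coeff f a l m \<noteq> 0"
        then have mem: "?m \<in> keys f"
          using hess_coeff_eq[OF refl, of f a l m] by (auto simp: in_keys_iff)
        have "keys ?m \<subseteq> {..<n}"
          using f(1) mem by (force simp: polys_in_def vars_def)
        then have "keys m \<subseteq> {..<n}" by (auto simp: in_keys_iff lookup_add subset_iff)
        moreover have "(\<Sum>v<n. lookup ?m v) = d"
        proof -
          have "(\<Sum>v<n. lookup ?m v) = (\<Sum>v\<in>keys ?m. lookup ?m v)"
            using \<open>keys ?m \<subseteq> {..<n}\<close> by (intro sum.mono_neutral_right) (auto simp: in_keys_iff)
          then show ?thesis using f(2) mem by (simp add: homogeneous_def)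
        qed
        then have "(\<Sum>v<n. lookup m v) + 2 = d"
          using that by (simp add: lookup_add sum.distrib lookup_single when_def)
        ultimately show False using False by auto
      qed
      have "equation n f m i j p = 0" if "p < n * n" for p
        using that ij zero less_mult_imp_div_less[OF that] by (simp add: equation_def)
      then show ?thesis by (simp add: dot_def)
    qed
  qed
  finally show ?thesis .
qed

section \<open>Echelon systems\<close>

text \<open>Partially filled echelon forms: \<open>piv p\<close> says that a row with pivot column \<open>p\<close> has been
  found, and this row is \<open>B p\<close>. Thus the columns without \<open>piv\<close> are the free ones.\<close>

definition solves :: "nat \<Rightarrow> (nat \<Rightarrow> bool) \<Rightarrow> (nat \<Rightarrow> nat \<Rightarrow> complex) \<Rightarrow> (nat \<Rightarrow> complex) \<Rightarrow> bool" where
  "solves N piv B x \<longleftrightarrow> (\<forall>p<N. piv p \<longrightarrow> dot N (B p) x = 0)"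

definition echelon :: "nat \<Rightarrow> (nat \<Rightarrow> bool) \<Rightarrow> (nat \<Rightarrow> nat \<Rightarrow> complex) \<Rightarrow> bool" where
  "echelon N piv B \<longleftrightarrow> (\<forall>p<N. piv p \<longrightarrow> B p p = 1 \<and> (\<forall>c<p. B p c = 0))"

lemma echelon_dot:
  assumes "echelon N piv B" "p < N" "piv p"
  shows "dot N (B p) x = x p + (\<Sum>c\<in>{p<..<N}. B p c * x c)"
proof -
  have split: "{..<N} = {..<p} \<union> insert p {p<..<N}" using assms(2) by auto
  have "(\<Sum>c<p. B p c * x c) = 0" using assms by (simp add: echelon_def)
  then show ?thesis unfolding dot_def split
    using assms by (subst sum.union_disjoint) (auto simp: echelon_def)
qed

text \<open>Solutions are determined by their values on the free columns: this is back substitution, so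
  the induction goes from the last column down.\<close>

lemma solves_zero:
  assumes B: "echelon N piv B" and x: "solves N piv B x" "\<And>p. p < N \<Longrightarrow> \<not> piv p \<Longrightarrow> x p = 0"
    and "p < N"
  shows "x p = 0"
  using \<open>p < N\<close>
proof (induction "N - p" arbitrary: p rule: less_induct)
  case less
  have "x c = 0" if "c \<in> {p<..<N}" for c using less that by auto
  then have "dot N (B p) x = x p" if "piv p" using echelon_dot[OF B less(2) that] by simp
  then show ?case using x less(2) by (cases "piv p") (auto simp: solves_def)
qed

text \<open>Setting the unknown of a pivot column makes its own row hold and leaves the later rows alone,
  because these vanish in that column. The program performs exactly this step.\<close>

lemma back_substitution_step:
  assumes B: "echelon N piv B" and p: "p < N" "piv p"
    and x: "\<And>p'. p < p' \<Longrightarrow> p' < N \<Longrightarrow> piv p' \<Longrightarrow> dot N (B p') x = 0"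
    and x': "\<And>c. c < N \<Longrightarrow> c \<noteq> p \<Longrightarrow> x' c = x c" "x' p = - (\<Sum>c\<in>{p<..<N}. B p c * x c)"
    and p': "p \<le> p'" "p' < N" "piv p'"
  shows "dot N (B p') x' = 0"
proof (cases "p' = p")
  case True
  then show ?thesis using x' by (simp add: echelon_dot[OF B p])
next
  case False
  then have "dot N (B p') x' = dot N (B p') x" using x' p'
    by (simp add: echelon_dot[OF B p'(2,3)])
  then show ?thesis using False p' x by simp
qed

lemma back_substitution:
  assumes B: "echelon N piv B"
  shows "\<exists>x. solves N piv B x \<and> (\<forall>p<N. \<not> piv p \<longrightarrow> x p = y p)"
proof -
  have "r \<le> N \<Longrightarrow> \<exists>x. (\<forall>p<N. N - r \<le> p \<longrightarrow> piv p \<longrightarrow> dot N (B p) x = 0) \<and>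
    (\<forall>p<N. \<not> piv p \<longrightarrow> x p = y p)" for r
  proof (induction r)
    case (Suc r)
    then obtain x where x: "\<And>p. p < N \<Longrightarrow> N - r \<le> p \<Longrightarrow> piv p \<Longrightarrow> dot N (B p) x = 0"
      "\<forall>p<N. \<not> piv p \<longrightarrow> x p = y p" by auto
    obtain p where p: "N - Suc r = p" "p < N" "\<And>p'. p < p' \<Longrightarrow> N - r \<le> p'"
      using Suc.prems by fastforce
    show ?case unfolding p(1)
    proof (cases "piv p")
      case True
      let ?x = "x(p := - (\<Sum>c\<in>{p<..<N}. B p c * x c))"
      have "dot N (B p') ?x = 0" if "p' < N" "p \<le> p'" "piv p'" for p'
      proof (rule back_substitution_step[OF B p(2) True _ _ _ that(2,1,3)])
        show "dot N (B p'') x = 0" if "p < p''" "p'' < N" "piv p''" for p''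
          using x(1) that p(3) by blast
      qed simp_all
      moreover have "\<forall>p<N. \<not> piv p \<longrightarrow> ?x p = y p" using x(2) True by simp
      ultimately show "\<exists>x. (\<forall>p'<N. p \<le> p' \<longrightarrow> piv p' \<longrightarrow> dot N (B p') x = 0) \<and>
        (\<forall>p<N. \<not> piv p \<longrightarrow> x p = y p)" by blast
    next
      case False
      then have "dot N (B p') x = 0" if "p' < N" "p \<le> p'" "piv p'" for p'
        using that x(1) p(3)[of p'] by (cases "p' = p") auto
      then show "\<exists>x. (\<forall>p'<N. p \<le> p' \<longrightarrow> piv p' \<longrightarrow> dot N (B p') x = 0) \<and>
        (\<forall>p<N. \<not> piv p \<longrightarrow> x p = y p)" using x(2) by blast
    qed
  qed auto
  from this[of N] show ?thesis by (auto simp: solves_def)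
qed

section \<open>A basis of the center\<close>

lemma center_space_simps:
  "carrier (center_space n f) = center n f"
  "add (center_space n f) = (+)"
  "zero (center_space n f) = 0\<^sub>m n n"
  "smult (center_space n f) = (\<cdot>\<^sub>m)"
  by (simp_all add: center_space_def module_mat_simps)

lemma lincomb_center_index:
  assumes "finite A" "A \<subseteq> center n f" "i < n" "j < n"
  shows "module.lincomb (center_space n f) a A $$ (i, j) = (\<Sum>M\<in>A. a M * M $$ (i, j))"
proof -
  interpret V: vectorspace "class_ring :: complex ring" "center_space n f"
    by (rule vectorspace_center_space)
  have cl: "V.lincomb a A \<in> center n f" if "A \<subseteq> center n f" for A
    using that V.lincomb_closed[of A a] by (simp add: center_space_simps class_ring_simps)
  show "V.lincomb a A $$ (i, j) = (\<Sum>M\<in>A. a M * M $$ (i, j))"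
    using assms(1,2)
  proof (induction A rule: finite_induct)
    case empty
    then show ?case using assms by (simp add: V.lincomb_def center_space_simps)
  next
    case (insert M A)
    have "V.lincomb a (A \<union> {M}) = a M \<cdot>\<^sub>m M + V.lincomb a A"
      using insert by (subst V.lincomb_insert) (auto simp: center_space_simps class_ring_simps)
    moreover have "M \<in> carrier_mat n n" "V.lincomb a A \<in> carrier_mat n n"
      using insert cl[of A] by (auto simp: center_def)
    ultimately show ?case using insert assms by simp
  qed
qed

text \<open>The coordinates of a matrix with respect to the fundamental solutions \<open>xs a\<close> are its entries
  in the free columns \<open>a\<close>. In particular the dimension is the number of free columns.\<close>

lemma fundamental_basis:
  fixes n :: nat and piv :: "nat \<Rightarrow> bool"
  defines "free \<equiv> {p. p < n * n \<and> \<not> piv p}"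
  assumes B: "echelon (n * n) piv B"
    and sol: "\<And>x. mat_of n x \<in> center n f \<longleftrightarrow> solves (n * n) piv B x"
    and xs: "\<And>a. a \<in> free \<Longrightarrow> solves (n * n) piv B (xs a)"
      "\<And>a p. a \<in> free \<Longrightarrow> p \<in> free \<Longrightarrow> xs a p = (if p = a then 1 else 0)"
  shows "inj_on (\<lambda>a. mat_of n (xs a)) free"
    and "vectorspace.basis class_ring (center_space n f) ((\<lambda>a. mat_of n (xs a)) ` free)"
    and "vectorspace.dim class_ring (center_space n f) = card free"
proof -
  interpret V: vectorspace "class_ring :: complex ring" "center_space n f"
    by (rule vectorspace_center_space)
  let ?M = "\<lambda>a. mat_of n (xs a)"
  let ?A = "?M ` free"
  have less: "a < n * n" if "a \<in> free" for a using that by (simp add: free_def)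
  show inj: "inj_on ?M free"
  proof (rule inj_onI)
    fix a b assume ab: "a \<in> free" "b \<in> free" "?M a = ?M b"
    then have "xs a a = xs b a" using less by (simp add: mat_of_eq_iff)
    then show "a = b" using ab by (simp add: xs split: if_splits)
  qed
  have fin: "finite ?A" by (simp add: free_def)
  have sub: "?A \<subseteq> center n f" using xs sol by auto
  have coords: "V.lincomb a ?A $$ (p div n, p mod n) = (\<Sum>b\<in>free. a (?M b) * xs b p)"
    if "p < n * n" for a p
  proof -
    have "p div n < n" "p mod n < n" using that less_mult_imp_div_less[OF that]
      by (cases "n = 0"; simp)+
    then have "V.lincomb a ?A $$ (p div n, p mod n) = (\<Sum>M\<in>?A. a M * M $$ (p div n, p mod n))"
      by (rule lincomb_center_index[OF fin sub])
    then show ?thesis using inj that by (simp add: sum.reindex mat_of_index)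
  qed
  have coord: "V.lincomb a ?A $$ (p div n, p mod n) = a (?M p)" if "p \<in> free" for a p
  proof -
    have "(\<Sum>b\<in>free. a (?M b) * xs b p) = (\<Sum>b\<in>free. if b = p then a (?M b) else 0)"
      using that by (intro sum.cong) (auto simp: xs)
    also have "\<dots> = a (?M p)" using that by (simp add: free_def)
    finally show ?thesis by (simp add: coords[OF less[OF that]])
  qed
  \<comment> \<open>By \<open>coord\<close> the coefficients of a linear combination can be recovered from it; conversely, the
    combination with these coefficients agrees with a given element of the center in the free
    columns, hence everywhere.\<close>
  show basis: "V.basis ?A"
  proof (subst V.basis_criterion[OF fin], safe)
    show "xa \<in> free \<Longrightarrow> ?M xa \<in> carrier (center_space n f)" for xa
      using sub by (auto simp: center_space_simps)
  next
    fix v assume "v \<in> carrier (center_space n f)"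
    then have v: "v \<in> center n f" by (simp add: center_space_simps)
    define x where "x p = v $$ (p div n, p mod n)" for p
    have vx: "v = mat_of n x" unfolding x_def using v by (intro mat_of_cover) (simp add: center_def)
    define c where "c = (\<lambda>M\<in>?A. x (inv_into free ?M M))"
    have cM: "c (?M b) = x b" if "b \<in> free" for b
      using inv_into_f_f[OF inj that] that by (simp add: c_def)
    have "V.lincomb c ?A \<in> center n f"
      using V.lincomb_closed[of ?A c] sub
      by (simp add: center_space_simps class_ring_simps)
    define z where "z p = V.lincomb c ?A $$ (p div n, p mod n)" for p
    have lz: "V.lincomb c ?A = mat_of n z"
      unfolding z_def using \<open>V.lincomb c ?A \<in> center n f\<close>
      by (intro mat_of_cover) (simp add: center_def)
    have "solves (n * n) piv B x" "solves (n * n) piv B z"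
      using v vx lz \<open>V.lincomb c ?A \<in> center n f\<close> sol by auto
    then have "solves (n * n) piv B (\<lambda>p. z p - x p)"
      by (simp add: solves_def dot_def algebra_simps sum_subtractf)
    then have "z p - x p = 0" if "p < n * n" for p
    proof (rule solves_zero[OF B])
      show "q < n * n \<Longrightarrow> \<not> piv q \<Longrightarrow> z q - x q = 0" for q
        using coord[of q c] cM[of q] by (simp add: free_def z_def)
    qed (rule that)
    then have "V.lincomb c ?A = v" unfolding lz vx mat_of_eq_iff by simp
    then show "\<exists>a. a \<in> ?A \<rightarrow>\<^sub>E carrier class_ring \<and> V.lincomb a ?A = v"
      by (intro exI[of _ c]) (auto simp: c_def class_ring_simps)
  next
    fix a a'
    assume a: "a \<in> ?A \<rightarrow>\<^sub>E carrier class_ring" "a' \<in> ?A \<rightarrow>\<^sub>E carrier class_ring"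
      and eq: "V.lincomb a' ?A = V.lincomb a ?A"
    have "a (?M b) = a' (?M b)" if "b \<in> free" for b
      using coord[OF that, of a] coord[OF that, of a'] eq by simp
    then show "a = a'" using a by (intro PiE_ext[OF a]) auto
  qed
  then show "V.dim = card free" using V.dim_basis[OF fin basis] inj by (simp add: card_image)
qed

text \<open>For the dimension the fundamental solutions only have to exist. This covers inputs on which the
  program stops without computing them.\<close>

lemma dim_center_space:
  assumes B: "echelon (n * n) piv B"
    and sol: "\<And>x. mat_of n x \<in> center n f \<longleftrightarrow> solves (n * n) piv B x"
  shows "vectorspace.dim class_ring (center_space n f) = card {p. p < n * n \<and> \<not> piv p}"
proof -
  have "\<exists>x. solves (n * n) piv B x \<and> (\<forall>p<n * n. \<not> piv p \<longrightarrow> x p = (if p = a then 1 else 0))" for a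
    by (rule back_substitution[OF B])
  then obtain xs where "\<And>a. solves (n * n) piv B (xs a)"
    "\<And>a p. p < n * n \<Longrightarrow> \<not> piv p \<Longrightarrow> xs a p = (if p = a then 1 else 0)" by metis
  then show ?thesis by (intro fundamental_basis(3)[where xs = xs, OF B sol]) auto
qed

section \<open>Tabulating the second derivatives\<close>

notation NAdd (infixl "+\<^sub>n" 65)
notation NSub (infixl "-\<^sub>n" 65)
notation NMul (infixl "*\<^sub>n" 70)
notation NDiv (infixl "div\<^sub>n" 70)
notation NMod (infixl "mod\<^sub>n" 70)

lemmas store_simps = get_def put_def put_nat_def put_nat_scalar

text \<open>Kronecker's delta as an expression: of the two truncated differences, both vanish exactly if the
  arguments are equal.\<close>

definition delta :: "nexp \<Rightarrow> nexp \<Rightarrow> nexp" where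
  "delta e e' = NConst 1 -\<^sub>n ((e -\<^sub>n e') +\<^sub>n (e' -\<^sub>n e))"

lemma nval_delta [simp]: "nval (delta e e') s = (if nval e s = nval e' s then 1 else 0)"
  by (auto simp: delta_def)

lemma nat_reads_delta [simp]: "nat_reads (delta e e') = nat_reads e \<union> nat_reads e'"
  by (auto simp: delta_def)

text \<open>Entry \<open>x = (k * n + i) * n + l\<close> of \<open>D\<close> is the coefficient that the \<open>k\<close>-th term contributes
  to \<open>\<partial>\<^sub>i \<partial>\<^sub>l f\<close>. There is no cast from natural numbers, so the natural factor, which is at most
  \<open>d\<^sup>2\<close>, is multiplied by repeated addition.\<close>

definition tabulate_derivatives :: com where
  "tabulate_derivatives =
     for_loop ''x'' (scalar ''t'' *\<^sub>n scalar ''n'' *\<^sub>n scalar ''n'')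
       (Seq (AssignNat ''m'' (NConst 0)
              (NElem ''E'' (scalar ''x'' div\<^sub>n (scalar ''n'' *\<^sub>n scalar ''n'') *\<^sub>n scalar ''n'' +\<^sub>n
                 scalar ''x'' mod\<^sub>n scalar ''n'') *\<^sub>n
               (NElem ''E'' (scalar ''x'' div\<^sub>n scalar ''n'') -\<^sub>n
                  delta (scalar ''x'' div\<^sub>n scalar ''n'' mod\<^sub>n scalar ''n'')
                        (scalar ''x'' mod\<^sub>n scalar ''n''))))
       (Seq (SetZero (''D'', scalar ''x''))
         (for_loop ''c'' (scalar ''m'')
            (Arith Add (''D'', scalar ''x'') (''D'', scalar ''x'')
               (''C'', scalar ''x'' div\<^sub>n (scalar ''n'' *\<^sub>n scalar ''n''))))))"

lemma writes_tabulate_derivatives [simp]: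
  "nat_writes tabulate_derivatives = {''x'', ''m'', ''c''}"
  "num_writes tabulate_derivatives = {''D''}"
  by (auto simp: tabulate_derivatives_def)

locale center_input =
  fixes n d :: nat and f :: cpoly and ms :: "monomial list"
  assumes n: "n \<ge> 1" and d: "d \<ge> 3" and f: "f \<in> polys_in n" "homogeneous d f"
    and ms: "distinct ms" "set ms = keys f"
begin

definition has_input :: "store \<Rightarrow> bool" where
  "has_input s \<longleftrightarrow> nats s ''n'' 0 = n \<and> nats s ''d'' 0 = d \<and> nats s ''t'' 0 = length ms \<and>
     (\<forall>k<length ms. \<forall>v<n. nats s ''E'' (k * n + v) = lookup (ms ! k) v) \<and>
     (\<forall>k<length ms. nums s ''C'' k = lookup f (ms ! k))"

lemma has_input_scalars:
  "has_input s \<Longrightarrow> nats s ''n'' 0 = n"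
  "has_input s \<Longrightarrow> nats s ''d'' 0 = d"
  "has_input s \<Longrightarrow> nats s ''t'' 0 = length ms"
  "has_input s \<Longrightarrow> k < length ms \<Longrightarrow> v < n \<Longrightarrow> nats s ''E'' (k * n + v) = lookup (ms ! k) v"
  "has_input s \<Longrightarrow> k < length ms \<Longrightarrow> nums s ''C'' k = lookup f (ms ! k)"
  by (auto simp: has_input_def)

lemma has_input_same_outside:
  "same_outside A B s s' \<Longrightarrow> ''n'' \<notin> A \<Longrightarrow> ''d'' \<notin> A \<Longrightarrow> ''t'' \<notin> A \<Longrightarrow> ''E'' \<notin> A \<Longrightarrow> ''C'' \<notin> B \<Longrightarrow>
   has_input s \<Longrightarrow> has_input s'"
  by (simp add: has_input_def same_outside_def)

lemma has_input_input_store: "has_input (input_store n d ms f)"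
proof -
  have "k * n + v < length ms * n" if "k < length ms" "v < n" for k v
  proof -
    have "k * n + v < Suc k * n" using that by simp
    also have "\<dots> \<le> length ms * n" using that by (intro mult_le_mono1) simp
    finally show ?thesis .
  qed
  then show ?thesis by (simp add: has_input_def input_store_def)
qed

definition deriv_table :: "nat \<Rightarrow> complex" where
  "deriv_table x = (let m = ms ! (x div (n * n)); i = x div n mod n; l = x mod n
     in of_nat (lookup m l * (lookup m i - (if i = l then 1 else 0))) * lookup f m)"

definition has_table :: "store \<Rightarrow> bool" where
  "has_table s \<longleftrightarrow> (\<forall>x<length ms * n * n. nums s ''D'' x = deriv_table x)"

lemma exponent_le_degree: "m \<in> keys f \<Longrightarrow> lookup m v \<le> d"
proof (cases "v \<in> keys m")
  case True
  assume "m \<in> keys f"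
  then show ?thesis using f(2) member_le_sum[OF True, of "lookup m"] by (auto simp: homogeneous_def)
qed (simp add: in_keys_iff)

lemma table_index:
  assumes "x < length ms * n * n"
  shows "x div (n * n) < length ms" "x mod n < n" "x div n mod n < n"
    "x div n = x div (n * n) * n + x div n mod n"
  using assms n by (simp_all add: less_mult_imp_div_less mult.assoc div_mult2_eq)

lemma runs_tabulate_derivatives:
  assumes s: "has_input s"
  shows "runs tabulate_derivatives s (length ms * n * n * (d * d)) has_table"
  unfolding tabulate_derivatives_def
proof (rule runs_for_loop[where N = "length ms * n * n" and b = "d * d"
      and I = "\<lambda>x s'. \<forall>x'<x. nums s' ''D'' x' = deriv_table x'"], goal_cases)
  case (6 x s')
  have s': "has_input s'" by (rule has_input_same_outside[OF 6(4) _ _ _ _ _ s]) simp_all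
  define k i l where "k = x div (n * n)" and "i = x div n mod n" and "l = x mod n"
  have ix: "k < length ms" "i < n" "l < n" "x div n = k * n + i"
    using table_index[OF 6(1)] by (simp_all add: k_def i_def l_def)
  define m where "m = lookup (ms ! k) l * (lookup (ms ! k) i - (if i = l then 1 else 0))"
  have "ms ! k \<in> keys f" using nth_mem[OF ix(1)] unfolding ms(2) .
  then have "lookup (ms ! k) v \<le> d" for v by (rule exponent_le_degree)
  then have m_le: "m \<le> d * d"
    unfolding m_def by (intro mult_le_mono le_trans[OF diff_le_self])
  have entry: "deriv_table x = of_nat m * lookup f (ms ! k)"
    by (simp add: deriv_table_def Let_def k_def i_def l_def m_def)
  show ?case
  proof (rule runs_Seq_free, rule runs_AssignNat, rule runs_Seq_free, rule runs_SetZero,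
      rule runs_for_loop[where N = m and b = 1 and
        I = "\<lambda>c s'. (\<forall>x'<x. nums s' ''D'' x' = deriv_table x') \<and>
          nums s' ''D'' x = of_nat c * lookup f (ms ! k)"], goal_cases)
    case 1
    have "nats s' ''E'' (x div n) = lookup (ms ! k) i"
      using has_input_scalars(4)[OF s' ix(1,2)] ix(4) by simp
    then show ?case using 6(3) has_input_scalars(4)[OF s' ix(1,3)]
      by (simp add: store_simps has_input_scalars[OF s'] m_def k_def i_def l_def)
  next
    case (6 c s'')
    then have "nats s'' ''n'' 0 = n" "nats s'' ''x'' 0 = x" "nums s'' ''C'' k = lookup f (ms ! k)"
      using \<open>nats s' ''x'' 0 = x\<close> ix(1)
      by (auto simp: same_outside_def store_simps has_input_scalars[OF s'])
    then show ?case using 6 by (intro runs_Arith) (auto simp: store_simps algebra_simps k_def)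
  next
    case (7 s'')
    then show ?case using entry less_Suc_eq by auto
  qed (use 6 m_le in \<open>auto simp: store_simps\<close>)
qed (use s in \<open>auto simp: has_input_scalars has_table_def\<close>)

end

section \<open>Writing down one equation\<close>

text \<open>The exponents of the monomial of equation \<open>y\<close> are accumulated digit by digit in the array
  \<open>M\<close>.\<close>

definition write_monomial :: com where
  "write_monomial =
     Seq (for_loop ''v'' (scalar ''n'') (AssignNat ''M'' (scalar ''v'') (NConst 0)))
     (Seq (AssignNat ''z'' (NConst 0) (scalar ''y'' div\<^sub>n (scalar ''n'' *\<^sub>n scalar ''n'')))
       (for_loop ''w'' (scalar ''d'' -\<^sub>n NConst 2)
         (Seq (AssignNat ''M'' (scalar ''z'' mod\<^sub>n scalar ''n'')
                (NElem ''M'' (scalar ''z'' mod\<^sub>n scalar ''n'') +\<^sub>n NConst 1))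
           (AssignNat ''z'' (NConst 0) (scalar ''z'' div\<^sub>n scalar ''n'')))))"

lemma writes_write_monomial [simp]:
  "nat_writes write_monomial = {''v'', ''M'', ''z'', ''w''}"
  "num_writes write_monomial = {}"
  by (auto simp: write_monomial_def)

text \<open>The coefficient of the monomial with exponents \<open>M\<close> in \<open>\<partial>\<^sub>a \<partial>\<^sub>l f\<close> comes from the term of \<open>f\<close>
  that is this monomial times \<open>x\<^sub>a x\<^sub>l\<close>. The search for this term handles only natural numbers,
  hence it is not counted.\<close>

definition fetch_coeff :: "name \<Rightarrow> com" where
  "fetch_coeff a =
     Seq (SetZero (''W'', NConst 0))
       (for_loop ''k'' (scalar ''t'')
         (Seq (AssignNat ''h'' (NConst 0) (NConst 1))
         (Seq (for_loop ''v'' (scalar ''n'')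
                (IfNat (BEq (NElem ''E'' (scalar ''k'' *\<^sub>n scalar ''n'' +\<^sub>n scalar ''v''))
                   (NElem ''M'' (scalar ''v'') +\<^sub>n delta (scalar ''v'') (scalar a) +\<^sub>n
                      delta (scalar ''v'') (scalar ''l'')))
                  Skip (AssignNat ''h'' (NConst 0) (NConst 0))))
           (IfNat (BEq (scalar ''h'') (NConst 1))
              (Copy (''W'', NConst 0)
                 (''D'', (scalar ''k'' *\<^sub>n scalar ''n'' +\<^sub>n scalar a) *\<^sub>n scalar ''n'' +\<^sub>n scalar ''l''))
              Skip))))"

lemma writes_fetch_coeff [simp]:
  "nat_writes (fetch_coeff a) = {''k'', ''h'', ''v''}"
  "num_writes (fetch_coeff a) = {''W''}"
  by (auto simp: fetch_coeff_def)

definition write_equation :: com where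
  "write_equation =
     Seq write_monomial
     (Seq (AssignNat ''i'' (NConst 0) (scalar ''y'' div\<^sub>n scalar ''n'' mod\<^sub>n scalar ''n''))
     (Seq (AssignNat ''j'' (NConst 0) (scalar ''y'' mod\<^sub>n scalar ''n''))
     (Seq (for_loop ''p'' (scalar ''n'' *\<^sub>n scalar ''n'') (SetZero (''R'', scalar ''p'')))
       (for_loop ''l'' (scalar ''n'')
         (Seq (Seq (fetch_coeff ''i'')
           (Arith Add (''R'', scalar ''l'' *\<^sub>n scalar ''n'' +\<^sub>n scalar ''j'')
              (''R'', scalar ''l'' *\<^sub>n scalar ''n'' +\<^sub>n scalar ''j'') (''W'', NConst 0)))
         (Seq (fetch_coeff ''j'')
           (Arith Sub (''R'', scalar ''l'' *\<^sub>n scalar ''n'' +\<^sub>n scalar ''i'')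
              (''R'', scalar ''l'' *\<^sub>n scalar ''n'' +\<^sub>n scalar ''i'') (''W'', NConst 0))))))))"

lemma writes_write_equation [simp]:
  "nat_writes write_equation =
     {''v'', ''M'', ''z'', ''w'', ''i'', ''j'', ''p'', ''l'', ''k'', ''h''}"
  "num_writes write_equation = {''R'', ''W''}"
  by (auto simp: write_equation_def)

context center_input
begin

definition has_monomial :: "monomial \<Rightarrow> store \<Rightarrow> bool" where
  "has_monomial m s \<longleftrightarrow> (\<forall>v<n. nats s ''M'' v = lookup m v)"

lemma runs_write_monomial:
  assumes s: "has_input s" and y: "nats s ''y'' 0 = y"
  shows "runs write_monomial s 0 (has_monomial (digit_mono n (d - 2) (y div (n * n))))"
  unfolding write_monomial_def
proof (rule runs_Seq_free, rule runs_for_loop[where N = n and b = 0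
      and I = "\<lambda>v s'. \<forall>v'<v. nats s' ''M'' v' = 0"], goal_cases)
  case (6 v s')
  then show ?case by (intro runs_AssignNat) (auto simp: store_simps less_Suc_eq)
next
  case (7 s')
  have s': "has_input s'" by (rule has_input_same_outside[OF 7(2) _ _ _ _ _ s]) simp_all
  have y': "nats s' ''y'' 0 = y" using 7(2) y by (simp add: same_outside_def)
  let ?q = "y div (n * n)"
  show ?case
  proof (rule runs_Seq_free, rule runs_AssignNat,
      rule runs_for_loop[where N = "d - 2" and b = 0 and
        \<comment> \<open>the digits read so far together with those still contained in \<open>z\<close>\<close>
        I = "\<lambda>w s'. \<forall>v<n. nats s' ''M'' v + lookup (digit_mono n (d - 2 - w) (nats s' ''z'' 0)) v
          = lookup (digit_mono n (d - 2) ?q) v"], goal_cases)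
    case (6 w s'')
    have "nats s'' ''n'' 0 = n"
      using 6(4) by (simp add: same_outside_def store_simps has_input_scalars[OF s'])
    moreover have "d - 2 - w = Suc (d - 2 - Suc w)" using 6(1) by simp
    ultimately show ?case using 6(2)
      by (intro runs_Seq_free runs_AssignNat)
        (auto simp: store_simps lookup_add lookup_single when_def)
  qed (use 7 y' in \<open>auto simp: store_simps has_input_scalars[OF s'] has_monomial_def\<close>)
qed (use s in \<open>auto simp: has_input_scalars\<close>)

lemma term_matches_iff:
  assumes "keys m \<subseteq> {..<n}" "a < n" "l < n" "k < length ms"
  shows "ms ! k = m + single a 1 + single l 1 \<longleftrightarrow>
    (\<forall>v<n. lookup (ms ! k) v = lookup m v + (if v = a then 1 else 0) + (if v = l then 1 else 0))"
proof -
  have "ms ! k \<in> keys f" using nth_mem[OF assms(4)] unfolding ms(2) .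
  then have "keys (ms ! k) \<subseteq> {..<n}" using f(1) by (force simp: polys_in_def vars_def)
  then have zero: "lookup (ms ! k) v = 0" "lookup m v = 0" if "\<not> v < n" for v
    using assms(1) that by (auto simp: in_keys_iff subset_iff)
  have "ms ! k = m + single a 1 + single l 1 \<longleftrightarrow>
      (\<forall>v. lookup (ms ! k) v = lookup (m + single a 1 + single l 1) v)"
    by (metis poly_mapping_eqI)
  also have "\<dots> \<longleftrightarrow> (\<forall>v<n. lookup (ms ! k) v = lookup (m + single a 1 + single l 1) v)"
  proof -
    have "lookup (ms ! k) v = lookup (m + single a 1 + single l 1) v" if "\<not> v < n" for v
      using that assms zero[OF that] by (auto simp: lookup_add lookup_single when_def)
    then show ?thesis by blast
  qed
  also have "\<dots> \<longleftrightarrow>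
    (\<forall>v<n. lookup (ms ! k) v = lookup m v + (if v = a then 1 else 0) + (if v = l then 1 else 0))"
    by (intro all_cong) (auto simp: lookup_add lookup_single when_def)
  finally show ?thesis .
qed

lemma deriv_table_match:
  assumes "a < n" "l < n" "ms ! k = m + single a 1 + single l 1"
  shows "deriv_table ((k * n + a) * n + l) = hess_coeff f a l m"
proof -
  have "((k * n + a) * n + l) div n = k * n + a" "((k * n + a) * n + l) div (n * n) = k"
    using assms by (simp_all add: div_mult2_eq)
  then show ?thesis using assms
    by (simp add: deriv_table_def Let_def hess_coeff_eq[OF assms(3)])
qed

text \<open>If no term matches, then the coefficient is zero, which is the initial value of \<open>W\<close>.\<close>

lemma runs_fetch_coeff:
  assumes s: "has_input s" "has_table s" "has_monomial m s"
    and a: "nats s a 0 = a'" "a' < n" "a \<notin> {''k'', ''h'', ''v''}"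
    and l: "nats s ''l'' 0 = l" "l < n" and m: "keys m \<subseteq> {..<n}"
  shows "runs (fetch_coeff a) s 0 (\<lambda>s'. nums s' ''W'' 0 = hess_coeff f a' l m)"
proof -
  define found where "found k \<longleftrightarrow> ms ! k = m + single a' 1 + single l 1" for k
  show ?thesis unfolding fetch_coeff_def
  proof (rule runs_Seq_free, rule runs_SetZero, rule runs_for_loop[where N = "length ms" and b = 0
        and I = "\<lambda>k s'. nums s' ''W'' 0 = (if \<exists>k'<k. found k' then hess_coeff f a' l m else 0)"],
        goal_cases)
    case (6 k s')
    define match where "match v \<longleftrightarrow> lookup (ms ! k) v =
      lookup m v + (if v = a' then 1 else 0) + (if v = l then 1 else 0)" for v
    have s': "has_input s'" "has_table s'" "has_monomial m s'" "nats s' a 0 = a'" "nats s' ''l'' 0 = l"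
      using 6(4) s a l
      by (auto simp: same_outside_def store_simps has_input_def has_table_def has_monomial_def)
    show ?case
    proof (rule runs_Seq_free, rule runs_AssignNat, rule runs_Seq_free,
        rule runs_for_loop[where N = n and b = 0 and
          I = "\<lambda>v s''. nats s'' ''h'' 0 = (if \<forall>v'<v. match v' then 1 else 0)"], goal_cases)
      case (6 v s'')
      have "nats s'' ''n'' 0 = n" "nats s'' ''E'' (k * n + v) = lookup (ms ! k) v"
        "nats s'' ''M'' v = lookup m v" "nats s'' a 0 = a'" "nats s'' ''l'' 0 = l" "nats s'' ''k'' 0 = k"
        using 6(1,4) s' \<open>nats s' ''k'' 0 = k\<close> \<open>k < length ms\<close> a(3)
        by (auto simp: same_outside_def store_simps has_input_def has_monomial_def)
      then have cond: "bval (BEq (NElem ''E'' (scalar ''k'' *\<^sub>n scalar ''n'' +\<^sub>n scalar ''v''))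
          (NElem ''M'' (scalar ''v'') +\<^sub>n delta (scalar ''v'') (scalar a) +\<^sub>n
            delta (scalar ''v'') (scalar ''l''))) s'' \<longleftrightarrow> match v"
        using 6(3) by (simp add: match_def)
      have "(\<forall>v'<Suc v. match v') \<longleftrightarrow> (\<forall>v'<v. match v') \<and> match v"
        by (auto simp: less_Suc_eq)
      then show ?case using 6(2)
        by (intro runs_IfNat; unfold cond) (simp_all add: runs_Skip runs_AssignNat put_nat_scalar)
    next
      case (7 s'')
      have h: "nats s'' ''h'' 0 = (if found k then 1 else 0)"
        using 7(1) term_matches_iff[OF m a(2) l(2) \<open>k < length ms\<close>] by (simp add: match_def found_def)
      have "(k * n + a') * n + l < length ms * n * n"
      proof -
        have "(k * n + a') * n + l < Suc (k * n + a') * n" using l(2) by simp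
        also have "\<dots> \<le> Suc k * n * n" using a(2) by (intro mult_le_mono1) simp
        also have "\<dots> \<le> length ms * n * n" using \<open>k < length ms\<close> by (intro mult_le_mono1) simp
        finally show ?thesis .
      qed
      then have s'': "nums s'' ''D'' ((k * n + a') * n + l) = deriv_table ((k * n + a') * n + l)"
        "nats s'' ''n'' 0 = n" "nats s'' a 0 = a'" "nats s'' ''l'' 0 = l" "nats s'' ''k'' 0 = k"
        "nums s'' ''W'' 0 = nums s' ''W'' 0"
        using 7(2) s' \<open>nats s' ''k'' 0 = k\<close> a(3)
        by (auto simp: same_outside_def store_simps has_input_def has_table_def)
      have split: "(\<exists>k'<Suc k. found k') \<longleftrightarrow> (\<exists>k'<k. found k') \<or> found k"
        by (auto simp: less_Suc_eq)
      show ?case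
      proof (rule runs_IfNat, goal_cases)
        case 1
        then have "nats s'' ''h'' 0 = 1" by simp
        then have "found k" unfolding h by (cases "found k") simp_all
        then have "deriv_table ((k * n + a') * n + l) = hess_coeff f a' l m"
          unfolding found_def by (rule deriv_table_match[OF a(2) l(2)])
        then have "get (''D'', (scalar ''k'' *\<^sub>n scalar ''n'' +\<^sub>n scalar a) *\<^sub>n scalar ''n'' +\<^sub>n scalar ''l'') s''
            = hess_coeff f a' l m"
          by (simp add: get_def s''(1-5))
        then show ?case using \<open>found k\<close>
          by (intro runs_Copy) (simp add: put_def split)
      next
        case 2
        then have "\<not> found k" using h by (simp split: if_splits)
        then show ?case unfolding split using s''(6) 6(2) by (intro runs_Skip) simp
      qed
    qed (use s' a(3) in \<open>auto simp: store_simps has_input_scalars\<close>)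
  next
    case (7 s')
    have "hess_coeff f a' l m = 0" if "\<not> (\<exists>k<length ms. found k)"
    proof -
      have "m + single a' 1 + single l 1 \<notin> keys f"
        using that ms(2) unfolding found_def by (metis in_set_conv_nth)
      then show ?thesis using hess_coeff_eq[OF refl, of f a' l m] by (simp add: in_keys_iff)
    qed
    then show ?case using 7(1) by auto
  qed (use s a(3) in \<open>auto simp: store_simps has_input_scalars\<close>)
qed

text \<open>The search for the coefficients is free, so the cost is that of one addition and one
  subtraction for each \<open>l < n\<close>.\<close>

lemma runs_write_equation:
  assumes s: "has_input s" "has_table s" and y: "nats s ''y'' 0 = y"
  shows "runs write_equation s (n * 2)
    (\<lambda>s'. \<forall>p<n * n. nums s' ''R'' p = numbered_equation n d f y p)"
proof -
  define m i j where "m = digit_mono n (d - 2) (y div (n * n))" and "i = y div n mod n" and "j = y mod n"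
  have m: "keys m \<subseteq> {..<n}" and ij: "i < n" "j < n"
    using n keys_digit_mono by (auto simp: m_def i_def j_def)
  \<comment> \<open>the row after \<open>l\<close> passes, which have filled in the coefficients of the unknowns in the first
    \<open>l\<close> rows of \<open>X\<close>\<close>
  define R where "R l p = (if p div n < l then equation n f m i j p else 0)" for l p
  show ?thesis unfolding write_equation_def
  proof (rule runs_Seq_free, rule runs_call[OF runs_write_monomial[OF s(1) y]], rule runs_Seq_free,
      rule runs_AssignNat, rule runs_Seq_free, rule runs_AssignNat, rule runs_Seq_free,
      rule runs_for_loop[where N = "n * n" and b = 0 and
        I = "\<lambda>p s'. \<forall>p'<p. nums s' ''R'' p' = 0"], goal_cases)
    case (6 s1 p s')
    then show ?case by (intro runs_SetZero) (auto simp: store_simps less_Suc_eq)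
  next
    case (7 s1 s2)
    have s2: "has_input s2" "has_table s2" "has_monomial m s2" "nats s2 ''i'' 0 = i"
      "nats s2 ''j'' 0 = j"
      using 7 s y
      by (auto simp: same_outside_def store_simps has_input_def has_table_def has_monomial_def
          m_def i_def j_def)
    show ?case
    proof (rule runs_for_loop[where N = n and b = "1 + 1" and
          I = "\<lambda>l s'. \<forall>p<n * n. nums s' ''R'' p = R l p"], goal_cases)
      case (6 l s3)
      have s3: "has_input s3" "has_table s3" "has_monomial m s3" "nats s3 ''i'' 0 = i"
        "nats s3 ''j'' 0 = j"
        using 6(4) s2
        by (auto simp: same_outside_def has_input_def has_table_def has_monomial_def)
      let ?c = "\<lambda>i p. if p mod n = i \<and> p div n = l then 1 else 0"
      show ?case
      proof (rule runs_Seq, rule runs_Seq_free,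
          rule runs_call[OF runs_fetch_coeff[OF s3(1-4) ij(1) _ 6(3,1) m]], simp,
          rule runs_Arith, goal_cases)
        case (1 s4)
        let ?s4 = "put (''R'', scalar ''l'' *\<^sub>n scalar ''n'' +\<^sub>n scalar ''j'') (arith Add
          (get (''R'', scalar ''l'' *\<^sub>n scalar ''n'' +\<^sub>n scalar ''j'') s4) (get (''W'', NConst 0) s4)) s4"
        have s4: "has_input ?s4" "has_table ?s4" "has_monomial m ?s4" "nats ?s4 ''i'' 0 = i"
            "nats ?s4 ''j'' 0 = j" "nats ?s4 ''l'' 0 = l"
          using 1(2) s3 6(3)
          by (auto simp: same_outside_def store_simps has_input_def has_table_def has_monomial_def)
        have R4: "nums ?s4 ''R'' =
            (nums s3 ''R'')(l * n + j := nums s3 ''R'' (l * n + j) + hess_coeff f i l m)"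
          using 1 s3 6(3) by (auto simp: same_outside_def store_simps has_input_def)
        show ?case
        proof (rule runs_Seq_free, rule runs_call[OF runs_fetch_coeff[OF s4(1-3,5) ij(2) _ s4(6) 6(1) m]],
            simp, rule runs_Arith, goal_cases)
          case (1 s5)
          let ?s5 = "put (''R'', scalar ''l'' *\<^sub>n scalar ''n'' +\<^sub>n scalar ''i'') (arith Sub
            (get (''R'', scalar ''l'' *\<^sub>n scalar ''n'' +\<^sub>n scalar ''i'') s5) (get (''W'', NConst 0) s5)) s5"
          have R5: "nums ?s5 ''R'' = (nums ?s4 ''R'')
              (l * n + i := nums ?s4 ''R'' (l * n + i) - hess_coeff f j l m)"
            using 1 s4 by (auto simp: same_outside_def store_simps has_input_def)
          have "nums ?s5 ''R'' p = R (Suc l) p" if p: "p < n * n" for p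
          proof -
            have eq: "p = l * n + c \<longleftrightarrow> p div n = l \<and> p mod n = c" if "c < n" for c
              using that by auto
            show ?thesis using 6(2) p ij
              unfolding R5 R4 fun_upd_apply
              by (auto simp: eq R_def equation_def less_Suc_eq)
          qed
          then show ?case by blast
        qed simp_all
      qed simp_all
    next
      case (7 s3)
      have "p div n < n" if "p < n * n" for p using that by (rule less_mult_imp_div_less)
      then show ?case using 7(1) by (simp add: R_def numbered_equation_def m_def i_def j_def)
    qed (use s2 7 in \<open>auto simp: has_input_scalars R_def\<close>)
  qed (use s in \<open>auto simp: store_simps same_outside_def has_input_scalars\<close>)
qed

end

section \<open>Elimination\<close>

definition pivots :: "store \<Rightarrow> nat \<Rightarrow> bool" where
  "pivots s p \<longleftrightarrow> nats s ''piv'' p = 1"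

definition stored_rows :: "nat \<Rightarrow> store \<Rightarrow> nat \<Rightarrow> nat \<Rightarrow> complex" where
  "stored_rows N s p c = nums s ''B'' (p * N + c)"

lemma pivots_rows_set_scalar [simp]:
  "v \<noteq> ''piv'' \<Longrightarrow> pivots (set_scalar v x s) = pivots s"
  "stored_rows N (set_scalar v x s) = stored_rows N s"
  by (auto simp: pivots_def stored_rows_def fun_eq_iff)

text \<open>The factor \<open>R[p]\<close> is saved in \<open>P\<close>, since the loop overwrites it before it reaches the later
  columns.\<close>

definition reduce_row :: com where
  "reduce_row =
     Seq (Copy (''P'', NConst 0) (''R'', scalar ''p''))
       (for_loop ''c'' (scalar ''n'' *\<^sub>n scalar ''n'')
         (Seq (Arith Mul (''G'', NConst 0) (''P'', NConst 0)
                (''B'', scalar ''p'' *\<^sub>n (scalar ''n'' *\<^sub>n scalar ''n'') +\<^sub>n scalar ''c''))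
           (Arith Sub (''R'', scalar ''c'') (''R'', scalar ''c'') (''G'', NConst 0))))"

text \<open>Makes \<open>R\<close>, scaled to pivot 1, the new row \<open>p\<close>. Then \<open>R\<close> is cleared, so that the remaining
  columns of the pass over \<open>R\<close> need nothing but a zero test.\<close>

definition store_row :: com where
  "store_row =
     Seq (Copy (''P'', NConst 0) (''R'', scalar ''p''))
     (Seq (for_loop ''c'' (scalar ''n'' *\<^sub>n scalar ''n'')
            (Seq (Arith Div (''B'', scalar ''p'' *\<^sub>n (scalar ''n'' *\<^sub>n scalar ''n'') +\<^sub>n scalar ''c'')
                   (''R'', scalar ''c'') (''P'', NConst 0))
              (SetZero (''R'', scalar ''c''))))
       (AssignNat ''piv'' (scalar ''p'') (NConst 1)))"

lemma writes_reduce_row [simp]: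
  "nat_writes reduce_row = {''c''}" "num_writes reduce_row = {''P'', ''G'', ''R''}"
  by (auto simp: reduce_row_def)

lemma writes_store_row [simp]:
  "nat_writes store_row = {''c'', ''piv''}" "num_writes store_row = {''P'', ''B'', ''R''}"
  by (auto simp: store_row_def)

definition insert_row :: com where
  "insert_row =
     for_loop ''p'' (scalar ''n'' *\<^sub>n scalar ''n'')
       (IfZero (''R'', scalar ''p'') Skip
         (IfNat (BEq (NElem ''piv'' (scalar ''p'')) (NConst 1)) reduce_row store_row))"

lemma writes_insert_row [simp]:
  "nat_writes insert_row = {''p'', ''c'', ''piv''}"
  "num_writes insert_row = {''P'', ''G'', ''R'', ''B''}"
  by (auto simp: insert_row_def)

lemma runs_reduce_row:
  assumes s: "nats s ''n'' 0 = n" "nats s ''p'' 0 = p"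
  shows "runs reduce_row s (n * n * 2)
    (\<lambda>s'. nums s' ''R'' = (\<lambda>c. if c < n * n then nums s ''R'' c - nums s ''R'' p * stored_rows (n * n) s p c
       else nums s ''R'' c))"
  unfolding reduce_row_def
proof (rule runs_Seq_free, rule runs_Copy, rule runs_for_loop[where N = "n * n" and b = "1 + 1" and
      I = "\<lambda>k s'. nums s' ''R'' = (\<lambda>c. if c < k
        then nums s ''R'' c - nums s ''R'' p * stored_rows (n * n) s p c else nums s ''R'' c)"], goal_cases)
  case (6 k s')
  have s': "nats s' ''n'' 0 = n" "nats s' ''p'' 0 = p" "nums s' ''P'' 0 = nums s ''R'' p" 
    "nums s' ''B'' = nums s ''B''"
    using 6(4) s by (auto simp: same_outside_def store_simps)
  show ?case
  proof (rule runs_Seq, rule runs_Arith, rule runs_Arith, goal_cases)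
    case 1
    show ?case using 6(2,3) s' by (auto simp: store_simps stored_rows_def fun_eq_iff less_Suc_eq)
  qed simp_all
qed (use s in \<open>auto simp: store_simps\<close>)

lemma runs_store_row:
  assumes s: "nats s ''n'' 0 = n" "nats s ''p'' 0 = p" and R: "nums s ''R'' p \<noteq> 0"
  shows "runs store_row s (n * n)
    (\<lambda>s'. (\<forall>c. nums s' ''R'' c = (if c < n * n then 0 else nums s ''R'' c)) \<and>
      (\<forall>q c. c < n * n \<longrightarrow> stored_rows (n * n) s' q c =
         (if q = p then nums s ''R'' c / nums s ''R'' p else stored_rows (n * n) s q c)) \<and>
      pivots s' = (pivots s)(p := True))"
proof -
  define N where "N = n * n"
  \<comment> \<open>the array \<open>B\<close> after the first \<open>k\<close> entries of row \<open>p\<close> have been written\<close>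
  define B where "B k x = (if p * N \<le> x \<and> x < p * N + k
    then nums s ''R'' (x - p * N) / nums s ''R'' p else nums s ''B'' x)" for k x
  show ?thesis unfolding store_row_def N_def[symmetric]
  proof (rule runs_Seq_free, rule runs_Copy, rule runs_Seq_free_last,
      rule runs_for_loop[where N = N and b = 1 and
      I = "\<lambda>k s'. nums s' ''R'' = (\<lambda>c. if c < k then 0 else nums s ''R'' c) \<and> nums s' ''B'' = B k"],
      goal_cases)
    case (6 k s')
    have s': "nats s' ''n'' 0 = n" "nats s' ''p'' 0 = p" "nums s' ''P'' 0 = nums s ''R'' p"
      using 6(4) s by (auto simp: same_outside_def store_simps)
    show ?case
    proof (rule runs_Seq_free_last, rule runs_Arith, rule runs_SetZero, goal_cases)
      case 1
      have "B (Suc k) = (B k)(p * N + k := nums s ''R'' k / nums s ''R'' p)"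
        by (auto simp: B_def fun_eq_iff)
      then show ?case
        using 6(2,3) s' by (auto simp: store_simps N_def less_Suc_eq fun_eq_iff)
    qed (use s' R in \<open>simp_all add: store_simps\<close>)
  next
    case (7 s')
    have row: "B N (q * N + c) = (if q = p then nums s ''R'' c / nums s ''R'' p else stored_rows N s q c)"
      if "c < N" for q c
    proof -
      have "p * N \<le> q * N + c \<and> q * N + c < p * N + N \<longleftrightarrow> q = p"
      proof
        assume a: "p * N \<le> q * N + c \<and> q * N + c < p * N + N"
        have "(q * N + c) div N = q" using that by simp
        moreover have "(q * N + c) div N = p"
          using a by (intro div_nat_eqI) (simp_all add: mult.commute)
        ultimately show "q = p" by simp
      qed (use that in simp)
      then show ?thesis by (auto simp: B_def stored_rows_def)
    qed
    have "nats s' ''p'' 0 = p" "nats s' ''piv'' = nats s ''piv''"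
      using 7(2) s by (auto simp: same_outside_def store_simps)
    then show ?case using 7(1) row
      by (intro runs_AssignNat) (auto simp: store_simps stored_rows_def pivots_def fun_eq_iff)
  qed (use s in \<open>auto simp: store_simps B_def N_def fun_eq_iff\<close>)
qed

lemma solves_reduce:
  assumes "solves N piv B x" "piv p" "p < N"
  shows "dot N (\<lambda>c. if c < N then r c - a * B p c else r c) x = dot N r x"
proof -
  have "dot N (\<lambda>c. if c < N then r c - a * B p c else r c) x = dot N r x - a * dot N (B p) x"
    by (simp add: dot_def algebra_simps sum_subtractf sum_distrib_left)
  then show ?thesis using assms by (simp add: solves_def)
qed

lemma solves_insert:
  assumes B': "\<And>q c. c < N \<Longrightarrow> B' q c = (if q = p then r c / a else B q c)"
    and p: "p < N" "\<not> piv p" and a: "a \<noteq> 0"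
  shows "solves N (piv(p := True)) B' x \<longleftrightarrow> solves N piv B x \<and> dot N r x = 0"
proof -
  have "dot N (B' p) x = dot N r x / a"
    using B' by (simp add: dot_def sum_divide_distrib)
  moreover have "dot N (B' q) x = dot N (B q) x" if "q \<noteq> p" for q
    using B' that by (simp add: dot_def)
  ultimately show ?thesis using p a by (auto simp: solves_def)
qed

text \<open>The pass over the columns of \<open>R\<close> preserves the common solutions of the stored rows and of \<open>R\<close>, and
  it clears \<open>R\<close> column by column. At the end \<open>R\<close> is zero, so its information has moved into the stored
  rows. Per column there is a zero test and at most one row operation, of up to \<open>2 n\<^sup>2\<close> arithmetic
  operations.\<close>

lemma runs_insert_row:
  assumes s: "nats s ''n'' 0 = n" and E: "echelon (n * n) (pivots s) (stored_rows (n * n) s)"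
  shows "runs insert_row s (n * n * (1 + n * n * 2)) (\<lambda>s'. echelon (n * n) (pivots s') (stored_rows (n * n) s') \<and>
    (\<forall>x. solves (n * n) (pivots s') (stored_rows (n * n) s') x \<longleftrightarrow>
      solves (n * n) (pivots s) (stored_rows (n * n) s) x \<and> dot (n * n) (nums s ''R'') x = 0))"
proof -
  define N where "N = n * n"
  show ?thesis unfolding insert_row_def N_def[symmetric]
  proof (rule runs_for_loop[where N = N and b = "Suc (N * 2)" and
        I = "\<lambda>p s'. echelon N (pivots s') (stored_rows N s') \<and> (\<forall>c<p. nums s' ''R'' c = 0) \<and>
          (\<forall>x. solves N (pivots s') (stored_rows N s') x \<and> dot N (nums s' ''R'') x = 0 \<longleftrightarrow>
            solves N (pivots s) (stored_rows N s) x \<and> dot N (nums s ''R'') x = 0)"], goal_cases)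
    case (6 p s')
    have s': "nats s' ''n'' 0 = n" using 6(4) s by (simp add: same_outside_def)
    have E': "echelon N (pivots s') (stored_rows N s')" and R': "\<And>c. c < p \<Longrightarrow> nums s' ''R'' c = 0"
      and sol': "\<And>x. solves N (pivots s') (stored_rows N s') x \<and> dot N (nums s' ''R'') x = 0 \<longleftrightarrow>
            solves N (pivots s) (stored_rows N s) x \<and> dot N (nums s ''R'') x = 0"
      using 6(2) by auto
    show ?case
    proof (rule runs_IfZero, goal_cases)
      case 1
      then show ?case using 6(2,3) by (intro runs_Skip) (auto simp: get_def less_Suc_eq)
    next
      case 2
      then have Rp: "nums s' ''R'' p \<noteq> 0" using 6(3) by (simp add: get_def)
      show ?case
      proof (rule runs_IfNat, goal_cases)
        case 1
        then have p: "pivots s' p" using 6(3) by (simp add: pivots_def)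
        show ?case
        proof (rule runs_conseq[OF runs_frame[OF runs_reduce_row[OF s' 6(3)]]], goal_cases)
          case (1 s1)
          then have R1: "nums s1 ''R'' = (\<lambda>c. if c < N
              then nums s' ''R'' c - nums s' ''R'' p * stored_rows N s' p c else nums s' ''R'' c)"
            and same: "pivots s1 = pivots s'" "stored_rows N s1 = stored_rows N s'"
            by (auto simp: N_def same_outside_def pivots_def stored_rows_def fun_eq_iff)
          have sol1: "solves N (pivots s') (stored_rows N s') x \<Longrightarrow>
              dot N (nums s1 ''R'') x = dot N (nums s' ''R'') x" for x
            unfolding R1 
            by (rule solves_reduce[where piv = "pivots s'" and B = "stored_rows N s'" and p = p, OF _ p 6(1)])
          have "nums s1 ''R'' c = 0" if "c < Suc p" for c
            using that E' R' p 6(1) by (cases "c = p") (auto simp: R1 echelon_def)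
          moreover have "solves N (pivots s') (stored_rows N s') x \<and> dot N (nums s1 ''R'') x = 0 \<longleftrightarrow>
              solves N (pivots s) (stored_rows N s) x \<and> dot N (nums s ''R'') x = 0" for x
            using sol1[of x] sol'[of x] by auto
          ultimately show ?case unfolding same using E' by (intro conjI allI impI)
        qed (simp add: N_def)
      next
        case 2
        then have p: "\<not> pivots s' p" using 6(3) by (simp add: pivots_def)
        show ?case
        proof (rule runs_conseq[OF runs_store_row[OF s' 6(3) Rp]], goal_cases)
          case (1 s1)
          then have R1: "\<And>c. c < N \<Longrightarrow> nums s1 ''R'' c = 0"
            and rows1: "\<And>q c. c < N \<Longrightarrow> stored_rows N s1 q c =
              (if q = p then nums s' ''R'' c / nums s' ''R'' p else stored_rows N s' q c)"
            and piv1: "pivots s1 = (pivots s')(p := True)"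
            by (simp_all add: N_def)
          have "echelon N (pivots s1) (stored_rows N s1)"
            unfolding echelon_def piv1
          proof (intro allI impI)
            fix q assume q: "q < N" "((pivots s')(p := True)) q"
            show "stored_rows N s1 q q = 1 \<and> (\<forall>c<q. stored_rows N s1 q c = 0)"
              using q E' R' Rp rows1 by (cases "q = p") (auto simp: echelon_def)
          qed
          moreover have "solves N (pivots s1) (stored_rows N s1) x \<longleftrightarrow>
              solves N (pivots s') (stored_rows N s') x \<and> dot N (nums s' ''R'') x = 0" for x
            unfolding piv1 
            by (rule solves_insert[where r = "nums s' ''R''" and a = "nums s' ''R'' p" and p = p and
                  B = "stored_rows N s'" and B' = "stored_rows N s1" and piv = "pivots s'",
                  OF rows1 6(1) p Rp])
          moreover have "dot N (nums s1 ''R'') x = 0" for x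
            using R1 by (simp add: dot_def)
          ultimately show ?case using sol' R1 6(1) by (intro conjI allI impI) simp_all
        qed (simp add: N_def)
      qed
    qed
  next
    case (7 s')
    then have "dot N (nums s' ''R'') x = 0" for x by (simp add: dot_def)
    then show ?case using 7(1) by simp
  qed (use s E in \<open>auto simp: N_def pivots_def stored_rows_def\<close>)
qed


definition eliminate :: com where
  "eliminate =
     Seq (AssignNat ''Q'' (NConst 0) (NConst 1))
     (Seq (for_loop ''c'' (scalar ''d'')
            (AssignNat ''Q'' (NConst 0) (scalar ''Q'' *\<^sub>n scalar ''n'')))
       (for_loop ''y'' (scalar ''Q'') (Seq write_equation insert_row)))"

lemma writes_eliminate [simp]:
  "nat_writes eliminate = {''Q'', ''c'', ''y'', ''v'', ''M'', ''z'', ''w'', ''i'', ''j'', ''p'',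
     ''l'', ''k'', ''h'', ''piv''}"
  "num_writes eliminate = {''R'', ''W'', ''P'', ''G'', ''B''}"
  by (auto simp: eliminate_def)

lemma (in center_input) runs_eliminate:
  assumes s: "has_input s" "has_table s" and piv: "\<And>p. \<not> pivots s p"
  shows "runs eliminate s (n ^ d * (n * 2 + n * n * (1 + n * n * 2)))
    (\<lambda>s'. echelon (n * n) (pivots s') (stored_rows (n * n) s') \<and>
      (\<forall>x. mat_of n x \<in> center n f \<longleftrightarrow> solves (n * n) (pivots s') (stored_rows (n * n) s') x))"
  unfolding eliminate_def
proof (rule runs_Seq_free, rule runs_AssignNat, rule runs_Seq_free,
    rule runs_for_loop[where N = d and b = 0 and I = "\<lambda>c s'. nats s' ''Q'' 0 = n ^ c"], goal_cases)
  case (6 c s')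
  then have "nats s' ''n'' 0 = n"
    using s by (simp add: same_outside_def store_simps has_input_scalars)
  then show ?case using 6(2) by (intro runs_AssignNat) (simp add: store_simps)
next
  case (7 s1)
  have s1: "has_input s1" "has_table s1" "\<And>p. \<not> pivots s1 p"
    using 7(2) s piv
    by (auto simp: same_outside_def store_simps has_input_def has_table_def pivots_def)
  show ?case
  proof (rule runs_for_loop[where N = "n ^ d" and b = "n * 2 + n * n * (1 + n * n * 2)" and
        I = "\<lambda>y s'. echelon (n * n) (pivots s') (stored_rows (n * n) s') \<and>
          (\<forall>x. solves (n * n) (pivots s') (stored_rows (n * n) s') x \<longleftrightarrow>
            (\<forall>y'<y. dot (n * n) (numbered_equation n d f y') x = 0))"], goal_cases)
    case (6 y s2)
    have s2: "has_input s2" "has_table s2"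
      using 6(4) s1 by (auto simp: same_outside_def has_input_def has_table_def)
    show ?case
    proof (rule runs_Seq, rule runs_call[OF runs_write_equation[OF s2 6(3)]], goal_cases)
      case (1 s3)
      have same: "pivots s3 = pivots s2" "stored_rows (n * n) s3 = stored_rows (n * n) s2"
        and s3: "nats s3 ''n'' 0 = n"
        using 1(2) s2
        by (auto simp: same_outside_def pivots_def stored_rows_def fun_eq_iff has_input_scalars)
      have E: "echelon (n * n) (pivots s3) (stored_rows (n * n) s3)"
        unfolding same using 6(2) by blast
      have "dot (n * n) (nums s3 ''R'') x = dot (n * n) (numbered_equation n d f y) x" for x
        using 1(1) by (simp add: dot_def)
      moreover have "(\<forall>y'<Suc y. dot (n * n) (numbered_equation n d f y') x = 0) \<longleftrightarrow>
          (\<forall>y'<y. dot (n * n) (numbered_equation n d f y') x = 0) \<and>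
          dot (n * n) (numbered_equation n d f y) x = 0" for x
        by (auto simp: less_Suc_eq)
      ultimately show ?case
        using runs_conseq[OF runs_insert_row[OF s3 E] _ order_refl] 6(2) unfolding same by simp
    qed
  next
    case (7 s2)
    then show ?case using mat_of_in_center_iff[of n d f] n d f by simp
  next
    case 5
    show ?case using s1(3) by (simp add: echelon_def solves_def)
  qed (use 7 in \<open>auto simp: pivots_def stored_rows_def\<close>)
qed (use s in \<open>auto simp: store_simps has_input_scalars\<close>)

section \<open>Reading off a basis\<close>

definition list_free :: com where
  "list_free =
     Seq (AssignNat ''u'' (NConst 0) (NConst 0))
       (for_loop ''p'' (scalar ''n'' *\<^sub>n scalar ''n'')
         (IfNat (BEq (NElem ''piv'' (scalar ''p'')) (NConst 1)) Skip
           (Seq (AssignNat ''F'' (scalar ''u'') (scalar ''p''))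
             (AssignNat ''u'' (NConst 0) (scalar ''u'' +\<^sub>n NConst 1)))))"

lemma writes_list_free [simp]:
  "nat_writes list_free = {''u'', ''p'', ''F''}"
  "num_writes list_free = {}"
  by (auto simp: list_free_def)

definition free_list :: "nat \<Rightarrow> store \<Rightarrow> nat list" where
  "free_list N s = filter (\<lambda>p. \<not> pivots s p) [0..<N]"

definition lists_free :: "nat list \<Rightarrow> store \<Rightarrow> bool" where
  "lists_free fs s \<longleftrightarrow> nats s ''u'' 0 = length fs \<and> (\<forall>a<length fs. nats s ''F'' a = fs ! a)"

lemma runs_list_free:
  assumes s: "nats s ''n'' 0 = n"
  shows "runs list_free s 0 (lists_free (free_list (n * n) s))"
  unfolding list_free_def
proof (rule runs_Seq_free, rule runs_AssignNat, rule runs_for_loop[where N = "n * n" and b = 0 and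
      I = "\<lambda>p. lists_free (free_list p s)"], goal_cases)
  case (6 p s')
  have piv: "nats s' ''piv'' p = nats s ''piv'' p"
    using 6(4) by (simp add: same_outside_def store_simps)
  show ?case
  proof (rule runs_IfNat, goal_cases)
    case 1
    then have "free_list (Suc p) s = free_list p s"
      using 6(3) piv by (simp add: free_list_def pivots_def)
    then show ?case using 6(2) by (intro runs_Skip) simp
  next
    case 2
    then have "free_list (Suc p) s = free_list p s @ [p]"
      using 6(3) piv by (simp add: free_list_def pivots_def)
    then show ?case using 6(2,3)
      by (intro runs_Seq_free runs_AssignNat)
        (auto simp: store_simps lists_free_def nth_append less_Suc_eq)
  qed
qed (use s in \<open>auto simp: store_simps lists_free_def free_list_def\<close>)

text \<open>Computes the fundamental solution of the \<open>a\<close>-th free column \<open>F[a]\<close> in the \<open>a\<close>-th block of \<open>X\<close>,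
  running through the pivot columns \<open>p\<close> from the last one down.\<close>

definition back_substitute :: com where
  "back_substitute =
     Seq (for_loop ''c'' (scalar ''n'' *\<^sub>n scalar ''n'')
       (SetZero (''X'', scalar ''a'' *\<^sub>n (scalar ''n'' *\<^sub>n scalar ''n'') +\<^sub>n scalar ''c'')))
     (Seq (SetOne (''X'', scalar ''a'' *\<^sub>n (scalar ''n'' *\<^sub>n scalar ''n'') +\<^sub>n NElem ''F'' (scalar ''a'')))
       (for_loop ''r'' (scalar ''n'' *\<^sub>n scalar ''n'')
         (Seq (AssignNat ''p'' (NConst 0) (scalar ''n'' *\<^sub>n scalar ''n'' -\<^sub>n (scalar ''r'' +\<^sub>n NConst 1)))
           (IfNat (BEq (NElem ''piv'' (scalar ''p'')) (NConst 1))
             (for_loop ''c'' (scalar ''n'' *\<^sub>n scalar ''n'')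
               (IfNat (BLess (scalar ''p'') (scalar ''c''))
                 (Seq (Arith Mul (''G'', NConst 0)
                        (''B'', scalar ''p'' *\<^sub>n (scalar ''n'' *\<^sub>n scalar ''n'') +\<^sub>n scalar ''c'')
                        (''X'', scalar ''a'' *\<^sub>n (scalar ''n'' *\<^sub>n scalar ''n'') +\<^sub>n scalar ''c''))
                   (Arith Sub (''X'', scalar ''a'' *\<^sub>n (scalar ''n'' *\<^sub>n scalar ''n'') +\<^sub>n scalar ''p'')
                      (''X'', scalar ''a'' *\<^sub>n (scalar ''n'' *\<^sub>n scalar ''n'') +\<^sub>n scalar ''p'')
                      (''G'', NConst 0)))
                 Skip))
             Skip))))"

lemma writes_back_substitute [simp]:
  "nat_writes back_substitute = {''c'', ''r'', ''p''}"
  "num_writes back_substitute = {''X'', ''G''}"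
  by (auto simp: back_substitute_def)

definition fundamental :: "nat \<Rightarrow> (nat \<Rightarrow> bool) \<Rightarrow> (nat \<Rightarrow> nat \<Rightarrow> complex) \<Rightarrow> nat \<Rightarrow> (nat \<Rightarrow> complex) \<Rightarrow> bool"
  where "fundamental N piv B b x \<longleftrightarrow>
    solves N piv B x \<and> (\<forall>p<N. \<not> piv p \<longrightarrow> x p = (if p = b then 1 else 0))"

lemma runs_back_substitute:
  assumes s: "nats s ''n'' 0 = n" "nats s ''a'' 0 = a" "nats s ''F'' a = b"
    and E: "echelon (n * n) (pivots s) (stored_rows (n * n) s)"
    and b: "b < n * n" "\<not> pivots s b"
  shows "runs back_substitute s (n * n * (n * n * 2))
    (\<lambda>s'. fundamental (n * n) (pivots s) (stored_rows (n * n) s) b (\<lambda>c. nums s' ''X'' (a * (n * n) + c)) \<and>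
      (\<forall>y<a * (n * n). nums s' ''X'' y = nums s ''X'' y))"
proof -
  define N where "N = n * n"
  define piv where "piv = pivots s"
  define B where "B = stored_rows N s"
  define x where "x s' c = nums s' ''X'' (a * N + c)" for s' :: store and c
  define kept where "kept s' \<longleftrightarrow> (\<forall>y<a * N. nums s' ''X'' y = nums s ''X'' y)" for s' :: store
  have x_cong: "x s' = x s''" "kept s' = kept s''" if "nums s' ''X'' = nums s'' ''X''" for s' s''
    using that by (simp_all add: x_def kept_def fun_eq_iff)
  show ?thesis unfolding back_substitute_def N_def[symmetric] piv_def[symmetric] B_def[symmetric]
      x_def[symmetric] kept_def[symmetric]
  proof (rule runs_Seq_free, rule runs_for_loop[where N = N and b = 0 and
        I = "\<lambda>c s'. (\<forall>c'<c. x s' c' = 0) \<and> kept s'"], goal_cases)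
    case (6 c s')
    have "nats s' ''n'' 0 = n" "nats s' ''a'' 0 = a" using 6(4) s by (auto simp: same_outside_def)
    then show ?case using 6(2,3)
      by (intro runs_SetZero) (auto simp: store_simps x_def kept_def N_def less_Suc_eq)
  next
    case (7 s1)
    have s1: "nats s1 ''n'' 0 = n" "nats s1 ''a'' 0 = a" "nats s1 ''F'' a = b"
      "nats s1 ''piv'' = nats s ''piv''" "nums s1 ''B'' = nums s ''B''"
      using 7(2) s by (auto simp: same_outside_def)
    \<comment> \<open>The last \<open>r\<close> columns are done. The earlier pivot columns have to hold 0, since the value of an
      unknown is built up in its own cell.\<close>
    define I where "I r s' \<longleftrightarrow> (\<forall>p<N. N - r \<le> p \<longrightarrow> piv p \<longrightarrow> dot N (B p) (x s') = 0) \<and>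
      (\<forall>p<N. \<not> piv p \<longrightarrow> x s' p = (if p = b then 1 else 0)) \<and>
      (\<forall>p<N - r. piv p \<longrightarrow> x s' p = 0) \<and> kept s'" for r s'
    show ?case
    proof (rule runs_Seq_free, rule runs_SetOne, rule runs_for_loop[where N = N and b = "N * 2" and
          I = I], goal_cases)
      case 5
      then show ?case using 7(1) s1 b
        by (auto simp: I_def store_simps x_def kept_def N_def piv_def)
    next
      case (6 r s2)
      define p where "p = N - Suc r"
      have p: "p < N" "N - r = Suc p" "N - Suc r = p" using 6(1) by (auto simp: p_def)
      have s2: "nats s2 ''n'' 0 = n" "nats s2 ''a'' 0 = a" "nats s2 ''piv'' = nats s ''piv''"
        "nums s2 ''B'' = nums s ''B''"
        using 6(4) s1 by (auto simp: same_outside_def store_simps)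
      note I = 6(2)[unfolded I_def p(2)]
      show ?case
      proof (rule runs_Seq_free, rule runs_AssignNat, rule runs_IfNat, goal_cases)
        case 1
        then have pivp: "piv p" using 6(3) s2 p by (simp add: store_simps piv_def pivots_def N_def)
        show ?case
        proof (rule runs_for_loop[where N = N and b = "1 + 1" and
              I = "\<lambda>c s'. nums s' ''X'' = (nums s2 ''X'')
                (a * N + p := - (\<Sum>c'\<in>{p<..<c}. B p c' * x s2 c'))"], goal_cases)
          case 5
          show ?case using I pivp by (auto simp: store_simps x_def fun_eq_iff)
        next
          case (6 c s3)
          have s3: "nats s3 ''n'' 0 = n" "nats s3 ''a'' 0 = a" "nats s3 ''p'' 0 = p"
            "nums s3 ''B'' = nums s ''B''"
            using 6(4) s2 p \<open>nats s2 ''r'' 0 = r\<close> by (auto simp: same_outside_def store_simps N_def)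
          show ?case
          proof (rule runs_IfNat, goal_cases)
            case 1
            then have "p < c" using 6(3) s3 by simp
            then have "{p<..<Suc c} = insert c {p<..<c}" by auto
            then have "(\<Sum>c'\<in>{p<..<Suc c}. B p c' * x s2 c') =
                B p c * x s2 c + (\<Sum>c'\<in>{p<..<c}. B p c' * x s2 c')" by simp
            moreover have "nums s3 ''X'' (a * N + c) = x s2 c" "nums s3 ''B'' (p * N + c) = B p c"
              using 6(2) s3 \<open>p < c\<close> by (simp_all add: x_def B_def stored_rows_def)
            ultimately show ?case using s3 6(2,3)
              by (intro runs_Seq runs_Arith) (simp_all add: store_simps N_def fun_eq_iff)
          next
            case 2
            then have "{p<..<Suc c} = {}" "{p<..<c} = {}" using 6(3) s3 by auto
            then show ?case using 6(2) by (intro runs_Skip) simp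
          qed
        next
          case (7 s3)
          have x3: "x s3 c = (if c = p then - (\<Sum>c'\<in>{p<..<N}. B p c' * x s2 c') else x s2 c)" for c
            using 7(1) by (simp add: x_def)
          have "dot N (B p') (x s3) = 0" if "p' < N" "p \<le> p'" "piv p'" for p'
          proof (rule back_substitution_step[of N piv B p "x s2"])
            show "dot N (B p'') (x s2) = 0" if "p < p''" "p'' < N" "piv p''" for p''
              using I that by simp
          qed (use E p that pivp x3 in \<open>simp_all add: N_def piv_def B_def\<close>)
          moreover have "kept s3" using I 7(1) by (simp add: kept_def)
          ultimately show ?case using I pivp unfolding I_def p(3) x3 by auto
        qed (use s2 in \<open>auto simp: store_simps N_def\<close>)
      next
        case 2
        then have pivp: "\<not> piv p" using 6(3) s2 p by (simp add: store_simps piv_def pivots_def N_def)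
        have same: "x (put_nat ''p'' e e' s2) = x s2" "kept (put_nat ''p'' e e' s2) = kept s2" for e e'
          by (intro x_cong; simp add: put_nat_def)+
        have "p' < N \<Longrightarrow> p \<le> p' \<Longrightarrow> piv p' \<Longrightarrow> Suc p \<le> p'" for p'
          using pivp by (cases "p' = p") auto
        then show ?case using I by (intro runs_Skip) (simp add: I_def p(3) same)
      qed
    next
      case (7 s2)
      then show ?case by (simp add: I_def fundamental_def solves_def)
    next
      case (4 i y s')
      have "x (set_scalar ''r'' y s') = x s'" "kept (set_scalar ''r'' y s') = kept s'"
        by (intro x_cong; simp)+
      then show ?case by (simp add: I_def)
    qed (use s1 in \<open>auto simp: store_simps N_def\<close>)
  qed (use s in \<open>auto simp: N_def x_def kept_def\<close>)
qed

definition output_basis :: com where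
  "output_basis =
     IfNat (BEq (scalar ''u'') (scalar ''n''))
       (Seq (AssignNat ''ok'' (NConst 0) (NConst 1))
         (for_loop ''a'' (scalar ''n'') back_substitute))
       Skip"

lemma output_mats_eq:
  "output_mats n s = map (\<lambda>a. mat_of n (\<lambda>c. nums s ''X'' (a * (n * n) + c))) [0..<n]"
  by (simp add: output_mats_def mat_of_def algebra_simps)

text \<open>The flag \<open>ok\<close> is initially 0, which reports a wrong dimension; only the case of dimension \<open>n\<close> has
  to change it.\<close>

lemma runs_output_basis:
  assumes s: "nats s ''n'' 0 = n" "nats s ''ok'' 0 = 0" "lists_free (free_list (n * n) s) s"
    and E: "echelon (n * n) (pivots s) (stored_rows (n * n) s)"
    and sol: "\<And>x. mat_of n x \<in> center n f \<longleftrightarrow> solves (n * n) (pivots s) (stored_rows (n * n) s) x"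
  shows "runs output_basis s (n * (n * n * (n * n * 2))) (outputs_center n f)"
proof -
  define N where "N = n * n"
  define piv where "piv = pivots s"
  define B where "B = stored_rows N s"
  define fs where "fs = free_list N s"
  have fs: "set fs = {p. p < N \<and> \<not> piv p}" "distinct fs"
    by (auto simp: fs_def free_list_def piv_def)
  have dim: "vectorspace.dim class_ring (center_space n f) = length fs"
    unfolding distinct_card[OF fs(2), symmetric] fs(1) unfolding N_def piv_def
    by (rule dim_center_space[OF E sol])
  have u: "nats s ''u'' 0 = length fs" "\<And>a. a < length fs \<Longrightarrow> nats s ''F'' a = fs ! a"
    using s(3) by (auto simp: lists_free_def fs_def N_def)
  show ?thesis unfolding output_basis_def
  proof (rule runs_IfNat, goal_cases)
    case 1
    then have len: "length fs = n" using s u by simp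
    show ?case
    proof (rule runs_Seq_free, rule runs_AssignNat, rule runs_for_loop[where N = n and
          b = "n * n * (n * n * 2)" and I = "\<lambda>a s'. \<forall>a'<a.
            fundamental N piv B (fs ! a') (\<lambda>c. nums s' ''X'' (a' * N + c))"], goal_cases)
      case (6 a s')
      have s': "nats s' ''n'' 0 = n" "nats s' ''F'' a = fs ! a" "pivots s' = piv"
          "stored_rows N s' = B"
        using 6(1,4) s u len
        by (auto simp: same_outside_def store_simps piv_def B_def pivots_def stored_rows_def fun_eq_iff)
      have "fs ! a \<in> set fs" using 6(1) len by simp
      then have b: "fs ! a < n * n" "\<not> pivots s' (fs ! a)" unfolding fs(1) s' N_def by auto
      show ?case
      proof (rule runs_conseq[OF runs_back_substitute[OF s'(1) 6(3) s'(2) _ b] _ order_refl], goal_cases)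
        case 1
        show ?case using E s' by (simp add: piv_def B_def N_def)
      next
        case (2 s'')
        have "fundamental N piv B (fs ! a') (\<lambda>c. nums s'' ''X'' (a' * N + c))" if "a' < Suc a" for a'
        proof (cases "a' = a")
          case True
          then show ?thesis using 2 s' by (simp add: N_def)
        next
          case False
          then have "a' < a" using that by simp
          have "nums s'' ''X'' (a' * N + c) = nums s' ''X'' (a' * N + c)" if "c < N" for c
          proof -
            have "a' * N + c < Suc a' * N" using that by simp
            also have "\<dots> \<le> a * N" using \<open>a' < a\<close> by (intro mult_le_mono1) simp
            finally show ?thesis using 2 by (simp add: N_def)
          qed
          moreover have "fundamental N piv B (fs ! a') (\<lambda>c. nums s' ''X'' (a' * N + c))"
            using 6(2) \<open>a' < a\<close> by blast
          ultimately show ?thesis by (simp add: fundamental_def solves_def dot_def)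
        qed
        then show ?case by blast
      qed
    next
      case (7 s')
      \<comment> \<open>The solutions are stored by position in \<open>fs\<close>, whereas \<open>fundamental_basis\<close> indexes them by
        free column.\<close>
      define X where "X a c = nums s' ''X'' (a * N + c)" for a c
      define xs where "xs b = X (inv_into {..<n} (nth fs) b)" for b
      have inj: "inj_on (nth fs) {..<n}"
        using fs(2) len by (intro inj_on_nth) auto
      have xs_nth: "xs (fs ! a) = X a" if "a < n" for a
        using inv_into_f_f[OF inj, of a] that by (simp add: xs_def)
      have fund: "fundamental N piv B b (xs b)" if b: "b \<in> set fs" for b
      proof -
        obtain a where "a < n" "b = fs ! a" using b len by (metis in_set_conv_nth)
        then show ?thesis using 7(1) xs_nth by (simp add: X_def[abs_def])
      qed
      have "output_mats n s' = map (\<lambda>a. mat_of n (xs (fs ! a))) [0..<n]"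
        unfolding output_mats_eq N_def[symmetric] by (simp add: xs_nth X_def[abs_def])
      also have "\<dots> = map (\<lambda>b. mat_of n (xs b)) fs"
        using map_nth[of fs] len by (metis (no_types, lifting) map_map comp_apply map_cong)
      finally have out: "output_mats n s' = map (\<lambda>b. mat_of n (xs b)) fs" .
      have basis: "inj_on (\<lambda>b. mat_of n (xs b)) (set fs)"
        "vectorspace.basis class_ring (center_space n f) ((\<lambda>b. mat_of n (xs b)) ` set fs)"
        unfolding fs(1) N_def using fund fs(1)
        by (intro fundamental_basis[OF E[folded N_def B_def piv_def, unfolded N_def] sol[folded N_def B_def piv_def, unfolded N_def]];
            simp add: fundamental_def N_def)+
      have "nats s' ''ok'' 0 = 1" using 7(2) by (simp add: same_outside_def store_simps)
      then show ?case
        using basis fs(2) dim len by (simp add: outputs_center_def out distinct_map)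
    qed (use s in \<open>auto simp: store_simps\<close>)
  next
    case 2
    then have "length fs \<noteq> n" using s u by simp
    then show ?case using dim s(2) by (intro runs_Skip) (simp add: outputs_center_def)
  qed
qed

definition center_program :: com where
  "center_program =
     Seq tabulate_derivatives (Seq eliminate (Seq list_free output_basis))"

lemma (in center_input) runs_center_program:
  "runs center_program (input_store n d ms f)
     (length ms * n * n * (d * d) +
      (n ^ d * (n * 2 + n * n * (1 + n * n * 2)) + n * (n * n * (n * n * 2)))) (outputs_center n f)"
  unfolding center_program_def
proof (rule runs_Seq, rule runs_call[OF runs_tabulate_derivatives[OF has_input_input_store]], goal_cases)
  case (1 s1)
  have input: "has_input s1"
    by (rule has_input_same_outside[OF 1(2) _ _ _ _ _ has_input_input_store]) simp_all
  have ok: "nats s1 ''ok'' 0 = 0" and piv: "\<And>p. \<not> pivots s1 p"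
    using same_outside_nats[OF 1(2), of "''ok''"] same_outside_nats[OF 1(2), of "''piv''"]
    by (simp_all add: pivots_def input_store_def)
  show ?case
  proof (rule runs_Seq, rule runs_call[OF runs_eliminate[OF input 1(1) piv]], goal_cases)
    case (1 s2)
    have s2: "nats s2 ''n'' 0 = n" "nats s2 ''ok'' 0 = 0"
      using 1(2) input ok by (auto simp: same_outside_def has_input_scalars)
    note elim = 1(1)
    show ?case
    proof (rule runs_Seq_free, rule runs_call[OF runs_list_free[OF s2(1)]], goal_cases)
      case (1 s3)
      have same: "pivots s3 = pivots s2" "stored_rows (n * n) s3 = stored_rows (n * n) s2"
        "free_list (n * n) s3 = free_list (n * n) s2" "nats s3 ''n'' 0 = n" "nats s3 ''ok'' 0 = 0"
        using 1(2) s2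
        by (auto simp: same_outside_def pivots_def stored_rows_def free_list_def fun_eq_iff)
      show ?case
        using 1(1) elim
        by (intro runs_output_basis) (simp_all add: same)
    qed
  qed
qed

theorem proposition3p2:
  shows "\<exists>(P :: com) (K :: nat).
    \<forall>(n :: nat) (d :: nat) (f :: cpoly) (ms :: monomial list).
      n \<ge> 1 \<longrightarrow> d \<ge> 3 \<longrightarrow>
      f \<in> polys_in n \<longrightarrow> homogeneous d f \<longrightarrow> nondegenerate n f \<longrightarrow>
      distinct ms \<longrightarrow> set ms = Poly_Mapping.keys f \<longrightarrow>
      (\<exists>k s. exec P (input_store n d ms f) k s \<and> outputs_center n f s \<and>
         k \<le> K * (n ^ 3 * d ^ 3 * card (Poly_Mapping.keys f) + n ^ (d + 4)))"
proof (rule exI[of _ center_program], rule exI[of _ 7], intro allI impI)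
  fix n d :: nat and f :: cpoly and ms :: "monomial list"
  assume *: "n \<ge> 1" "d \<ge> 3" "f \<in> polys_in n" "homogeneous d f" "nondegenerate n f"
    "distinct ms" "set ms = Poly_Mapping.keys f"
  interpret center_input n d f ms by unfold_locales (use * in auto)
  let ?t = "card (Poly_Mapping.keys f)"
  have t: "length ms = ?t" using * by (metis distinct_card)
  have "n * n * (d * d) \<le> n ^ 3 * d ^ 3"
    using * by (intro mult_le_mono) (auto simp: power3_eq_cube)
  then have 1: "?t * n * n * (d * d) \<le> n ^ 3 * d ^ 3 * ?t"
    by (simp add: mult.assoc mult.left_commute[of _ ?t])
  \<comment> \<open>The constant 7 is 2 + 1 + 2 for writing, testing and reducing the equations, plus 2 for the
    back substitutions.\<close>
  have pow: "n \<le> n ^ 4" "n * n \<le> n ^ 4" "n * n * (n * n * 2) = 2 * n ^ 4"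
    using * power_increasing[of 1 4 n] power_increasing[of 2 4 n]
    by (simp_all add: power2_eq_square power4_eq_xxxx)
  have "n * 2 + n * n * (1 + n * n * 2) \<le> 5 * n ^ 4"
    using pow by (simp add: algebra_simps)
  then have "n ^ d * (n * 2 + n * n * (1 + n * n * 2)) \<le> n ^ d * (5 * n ^ 4)"
    by (rule mult_le_mono2)
  also have "\<dots> = 5 * n ^ (d + 4)" by (simp add: power_add)
  finally have 2: "n ^ d * (n * 2 + n * n * (1 + n * n * 2)) \<le> 5 * n ^ (d + 4)" .
  have "n * (n * n * (n * n * 2)) = 2 * n ^ (1 + 4)" unfolding pow(3) power_add by simp
  also have "n ^ (1 + 4) \<le> n ^ (d + 4)" using * by (intro power_increasing) auto
  finally have 3: "n * (n * n * (n * n * 2)) \<le> 2 * n ^ (d + 4)" by simp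
  obtain k s where ks: "exec center_program (input_store n d ms f) k s" "outputs_center n f s"
    "k \<le> ?t * n * n * (d * d) +
      (n ^ d * (n * 2 + n * n * (1 + n * n * 2)) + n * (n * n * (n * n * 2)))"
    using runs_center_program unfolding runs_def t by blast
  have "k \<le> n ^ 3 * d ^ 3 * ?t + (5 * n ^ (d + 4) + 2 * n ^ (d + 4))"
    using ks(3) add_mono[OF 1 add_mono[OF 2 3]] by (rule order_trans)
  also have "\<dots> \<le> 7 * (n ^ 3 * d ^ 3 * ?t + n ^ (d + 4))" by simp
  finally have "k \<le> 7 * (n ^ 3 * d ^ 3 * ?t + n ^ (d + 4))" .
  with ks show "\<exists>k s. exec center_program (input_store n d ms f) k s \<and> outputs_center n f s \<and>
      k \<le> 7 * (n ^ 3 * d ^ 3 * ?t + n ^ (d + 4))"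
    by blast
qed

end
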